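(* Let $X$ be a square integrable random variable taking values in $\mathcal L(v_0,D)$ with maximal span $D$, $\mu=\mathbb E X$, $\sigma^2=\mathrm{Var}(X)>0$, and assume that $\vartheta_X>0$. Let $X_1,X_2,\ldots$ be independent copies of $X$ and $S_n=X_1+\cdots+X_n$. Let $\kappa$ be a real number, and let $\kappa_n\in\mathcal L(nv_0,D)$ be of the form $\kappa_n=n\mu+\kappa\sqrt n(1+\varepsilon_n)$ with $\varepsilon_n\to0$. Put $$\delta_n=\Big|\sigma\sqrt n\,\mathbb P\{S_n=\kappa_n\}-\frac{D}{\sqrt{2\pi}}e^{-\frac{(\kappa_n-n\mu)^2}{2n\sigma^2}}\Big|,$$ and let $b>3/2$. (i) Almost surely, as $N\to\infty$, $$\frac{\sum_{1\le n<2^{N+1}}\frac1{\sqrt n}\mathbf 1_{\{S_n=\kappa_n\}}}{\sum_{1\le n<2^{N+1}}\frac1n}=\frac{D}{\sigma\sqrt{2\pi}}e^{-\frac{\kappa^2}{2\sigma^2}}+\mathcal O\Big(\frac1N\sum_{1\le n<2^{N+1}}\frac{\delta_n+|\varepsilon_n|}{n}\Big)+o\Big(\frac{(\log N)^b}{N^{1/2}}\Big).$$ (ii) Assume that $$\sum_{j\ge2}\frac{1}{j^{1/2}(\log j)^b}\sum_{2^j\le n<2^{j+1}}\frac{\delta_n+|\varepsilon_n|}{n}<\infty$$ (this is fulfilled if $\max(\delta_n,|\varepsilon_n|)=\mathcal O(\log^{-1/2}n)$). Then the series $$\sum_{j\ge2}\frac1{j^{1/2}(\log j)^b}\bigg\{\sum_{2^j\le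 n<2^{j+1}}\frac1{\sqrt n}\mathbf 1_{\{S_n=\kappa_n\}}-\frac{D\log2}{\sigma\sqrt{2\pi}}e^{-\frac{\kappa^2}{2\sigma^2}}\bigg\}$$ converges almost surely.
   Context: $v_0\in\mathbb R$, $D>0$, $v_k=v_0+Dk$, $\mathcal L(v_0,D)=\{v_k:k\in\mathbb Z\}$, $\mathcal L(nv_0,D)=\{nv_0+Dk:k\in\mathbb Z\}$. The span $D$ is maximal if there are no reals $v_0'$ and $D'>D$ with $\mathbb P\{X\in\mathcal L(v_0',D')\}=1$. $\vartheta_X=\sum_{k\in\mathbb Z}\min(\mathbb P\{X=v_k\},\mathbb P\{X=v_{k+1}\})$. *)

theory Defs
  imports "HOL-Probability.Probability" "HOL-Library.Landau_Symbols"
begin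

definition lattice_set :: "real \<Rightarrow> real \<Rightarrow> real set"
  where "lattice_set v D = range (\<lambda>k::int. v + D * of_int k)"

definition maximal_span :: "'a measure \<Rightarrow> ('a \<Rightarrow> real) \<Rightarrow> real \<Rightarrow> bool"
  where "maximal_span P X D \<longleftrightarrow>
    \<not> (\<exists>v' D'. D' > D \<and> \<P>(\<omega> in P. X \<omega> \<in> lattice_set v' D') = 1)"

text \<open>The quantity \<open>\<vartheta>\<^sub>X\<close>. The summands are dominated by the point masses of \<open>X\<close> on distinct
  lattice points (for \<open>D \<noteq> 0\<close>), so the unordered sum exists.\<close>
definition lattice_overlap :: "'a measure \<Rightarrow> ('a \<Rightarrow> real) \<Rightarrow> real \<Rightarrow> real \<Rightarrow> real"
  where "lattice_overlap P X v D =
    (\<Sum>\<^sub>\<infinity>k\<in>(UNIV :: int set).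
       min (\<P>(\<omega> in P. X \<omega> = v + D * of_int k)) (\<P>(\<omega> in P. X \<omega> = v + D * of_int (k + 1))))"

end

theory Submission
  imports Defs
begin

text \<open>
  A positive overlap gives two adjacent atoms, hence \<open>|\<phi>(t)| \<le> exp (-c t\<^sup>2)\<close> on a full period of the
  characteristic function \<open>\<phi>\<close>. Fourier inversion on the lattice then yields
  \<open>\<P>(S\<^sub>m = \<kappa>\<^sub>m) = O(m\<^bsup>-1/2\<^esup>)\<close> and
  \<open>\<P>(S\<^sub>n - S\<^sub>m = \<kappa>\<^sub>n - \<kappa>\<^sub>m) - \<P>(S\<^sub>n = \<kappa>\<^sub>n) = O(m\<^bsup>1/2\<^esup> / (n - m))\<close>, so that the covariances of the
  normalised indicators, summed over \<open>n > m\<close>, are \<open>O(1/m)\<close>. Hence the centred partial sums \<open>T\<^sub>k\<close> over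
  \<open>n < 2\<^sup>k\<close> satisfy \<open>E (T\<^sub>k - T\<^sub>i)\<^sup>2 \<le> C (k - i)\<close>. A dyadic Rademacher--Menshov argument gives
  \<open>T\<^sub>k = o(k\<^bsup>1/2\<^esup> (log k)\<^sup>b)\<close> almost surely for \<open>b > 3/2\<close>, which is (i), and Abel summation turns this
  into the convergence of the weighted series in (ii). The means of the indicators differ from the stated limit by
  \<open>O((\<delta>\<^sub>n + |\<epsilon>\<^sub>n|)/n)\<close> because \<open>exp (-x)\<close> is 1-Lipschitz on the half-line.
\<close>

section \<open>Quasi-orthogonal increments\<close>

text \<open>The obstacle is dependence: hits at different times share their steps. As
  \<open>S_m\<close> and \<open>S_n - S_m\<close> are independent, a covariance is the small
  probability of the first hit times a difference of two lattice probabilities. By inversion their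
  integrands differ by the factor \<open>iexp (t * x) - char \<nu> t ^ m\<close>, which is
  \<open>O(sqrt m * |t|)\<close> since \<open>x\<close> lies within \<open>O(sqrt m)\<close> of the
  mean of \<open>S_m\<close>; Gaussian integration of the extra \<open>|t|\<close> turns
  \<open>1 / sqrt (n - m)\<close> into \<open>sqrt m / (n - m)\<close>. Time is counted in
  \<open>k = log_2 n\<close>, because the weights \<open>1/n\<close> have mass about
  \<open>ln 2\<close> on each dyadic block; hence second moments grow linearly in
  \<open>k - i\<close>. Origin of 3/2: the expected energy has one factor for the number of dyadic
  levels, and Cauchy-Schwarz costs another, so block \<open>r\<close> of the maximal estimate
  contributes order \<open>r powr (2 - 2 * b)\<close>, summable exactly when \<open>b > 3/2\<close>.
  In (ii), first moments of \<open>T\<close> control the Abel-transformed series, while its boundary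
  term is handled by the almost sure estimate behind (i).\<close>

primrec dyadic_energy :: "(nat \<Rightarrow> real) \<Rightarrow> nat \<Rightarrow> nat \<Rightarrow> real" where
  "dyadic_energy t 0 a = (t (Suc a) - t a)\<^sup>2"
| "dyadic_energy t (Suc r) a =
     (t (a + 2 ^ r) - t a)\<^sup>2 + dyadic_energy t r a + dyadic_energy t r (a + 2 ^ r)"

lemma dyadic_energy_nonneg: "dyadic_energy t r a \<ge> 0"
  by (induction r arbitrary: a) auto

text \<open>Cauchy-Schwarz for \<open>x * 1 + (y / sqrt s) * sqrt s\<close>. The weight is tuned so
  that one more increment raises the constant only from \<open>s\<close> to \<open>s + 1\<close>;
  equal weights would double it at every level.\<close>

lemma square_add_le_weighted:
  fixes x y q s :: real
  assumes "s > 0" "y\<^sup>2 \<le> s * q"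
  shows "(x + y)\<^sup>2 \<le> (s + 1) * (x\<^sup>2 + q)"
proof -
  have "0 \<le> (s * x - y)\<^sup>2" by simp
  then have "2 * s * (x * y) \<le> s\<^sup>2 * x\<^sup>2 + y\<^sup>2"
    by (simp add: power2_eq_square algebra_simps)
  also have "\<dots> \<le> s\<^sup>2 * x\<^sup>2 + s * q" using assms by simp
  finally have "s * (2 * (x * y)) \<le> s * (s * x\<^sup>2 + q)"
    by (simp add: power2_eq_square algebra_simps)
  then have "2 * (x * y) \<le> s * x\<^sup>2 + q" using assms(1) by simp
  then show ?thesis using assms(2) by (simp add: power2_eq_square algebra_simps)
qed

text \<open>Binary expansion of \<open>k\<close> reaches \<open>a + k\<close> from \<open>a\<close> through at most \<open>r + 1\<close> of the dyadic increments
  collected in the energy; Cauchy--Schwarz costs the factor \<open>r + 1\<close>.\<close>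

lemma dyadic_energy_bound:
  "k \<le> 2 ^ r \<Longrightarrow> (t (a + k) - t a)\<^sup>2 \<le> real (Suc r) * dyadic_energy t r a"
proof (induction r arbitrary: a k)
  case 0
  then have "k = 0 \<or> k = 1" by auto
  then show ?case by auto
next
  case (Suc r)
  show ?case
  proof (cases "k \<le> 2 ^ r")
    case True
    have "(t (a + k) - t a)\<^sup>2 \<le> real (Suc r) * dyadic_energy t r a" by (rule Suc.IH[OF True])
    also have "\<dots> \<le> real (Suc (Suc r)) * dyadic_energy t (Suc r) a"
      by (intro mult_mono) (auto simp: dyadic_energy_nonneg)
    finally show ?thesis .
  next
    case False
    define l where "l = k - 2 ^ r"
    have l: "l \<le> 2 ^ r" "k = 2 ^ r + l" using Suc.prems False by (auto simp: l_def)
    have "(t (a + 2 ^ r + l) - t (a + 2 ^ r))\<^sup>2 \<le> real (Suc r) * dyadic_energy t r (a + 2 ^ r)"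
      by (rule Suc.IH[OF l(1)])
    from square_add_le_weighted[OF _ this, of "t (a + 2 ^ r) - t a"]
    have "(t (a + k) - t a)\<^sup>2 \<le>
      (real (Suc r) + 1) * ((t (a + 2 ^ r) - t a)\<^sup>2 + dyadic_energy t r (a + 2 ^ r))"
      by (simp add: l(2) add.assoc)
    also have "\<dots> \<le> real (Suc (Suc r)) * dyadic_energy t (Suc r) a"
      by (intro mult_mono) (auto simp: dyadic_energy_nonneg)
    finally show ?thesis .
  qed
qed

text \<open>The energy collects the squared increments over all dyadic subintervals of
  \<open>[a, a + 2 ^ r]\<close>. The lengths on one level add up to \<open>2 ^ r\<close>, so each of
  the \<open>r + 1\<close> levels costs at most \<open>C * 2 ^ r\<close>.\<close>

lemma dyadic_energy_expectation:
  fixes T :: "nat \<Rightarrow> 'a \<Rightarrow> real"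
  assumes int: "\<And>i j. i \<le> j \<Longrightarrow> integrable M (\<lambda>\<omega>. (T j \<omega> - T i \<omega>)\<^sup>2)"
    and bnd: "\<And>i j. i \<le> j \<Longrightarrow> (\<integral>\<omega>. (T j \<omega> - T i \<omega>)\<^sup>2 \<partial>M) \<le> C * real (j - i)"
  shows "integrable M (\<lambda>\<omega>. dyadic_energy (\<lambda>k. T k \<omega>) r a)" (is ?A)
    and "(\<integral>\<omega>. dyadic_energy (\<lambda>k. T k \<omega>) r a \<partial>M) \<le> C * (real (Suc r) * 2 ^ r)" (is ?B)
proof -
  have "?A \<and> ?B"
  proof (induction r arbitrary: a)
    case 0
    show ?case using int[of a "Suc a"] bnd[of a "Suc a"] by simp
  next
    case (Suc r)
    have C: "0 \<le> C"
    using order_trans[OF Bochner_Integration.integral_nonneg bnd[of 0 1]] by simp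
    note IH = Suc.IH[of a] Suc.IH[of "a + 2 ^ r"]
    have "(\<integral>\<omega>. dyadic_energy (\<lambda>k. T k \<omega>) (Suc r) a \<partial>M) =
      (\<integral>\<omega>. (T (a + 2 ^ r) \<omega> - T a \<omega>)\<^sup>2 \<partial>M) + (\<integral>\<omega>. dyadic_energy (\<lambda>k. T k \<omega>) r a \<partial>M)
        + (\<integral>\<omega>. dyadic_energy (\<lambda>k. T k \<omega>) r (a + 2 ^ r) \<partial>M)"
      using IH int[of a "a + 2 ^ r"] by (simp add: Bochner_Integration.integral_add)
    also have "\<dots> \<le> C * real (2 ^ r) + C * (real (Suc r) * 2 ^ r) + C * (real (Suc r) * 2 ^ r)"
      using IH bnd[of a "a + 2 ^ r"] by (intro add_mono) auto
    also have "\<dots> \<le> C * (real (Suc (Suc r)) * 2 ^ Suc r)"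
      using C by (simp add: algebra_simps)
    finally show ?case using IH int[of a "a + 2 ^ r"] by auto
  qed
  then show ?A ?B by auto
qed

text \<open>Tonelli: the sum has finite expectation, hence is finite almost everywhere.\<close>

lemma AE_summable_nonneg:
  fixes f :: "nat \<Rightarrow> 'a \<Rightarrow> real"
  assumes int: "\<And>i. integrable M (f i)" and pos: "\<And>i \<omega>. 0 \<le> f i \<omega>"
    and sum: "summable (\<lambda>i. \<integral>\<omega>. f i \<omega> \<partial>M)"
  shows "AE \<omega> in M. summable (\<lambda>i. f i \<omega>)"
proof -
  have [measurable]: "f i \<in> borel_measurable M" for i using int by auto
  have "(\<integral>\<^sup>+\<omega>. (\<Sum>i. ennreal (f i \<omega>)) \<partial>M) = (\<Sum>i. \<integral>\<^sup>+\<omega>. ennreal (f i \<omega>) \<partial>M)"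
    by (rule nn_integral_suminf) simp
  also have "\<dots> = (\<Sum>i. ennreal (\<integral>\<omega>. f i \<omega> \<partial>M))"
    by (simp add: nn_integral_eq_integral int pos)
  also have "\<dots> = ennreal (\<Sum>i. \<integral>\<omega>. f i \<omega> \<partial>M)"
    by (rule suminf_ennreal_eq) (auto intro: sum summable_sums simp: pos)
  finally have "(\<integral>\<^sup>+\<omega>. (\<Sum>i. ennreal (f i \<omega>)) \<partial>M) \<noteq> \<infinity>" by simp
  then have "AE \<omega> in M. (\<Sum>i. ennreal (f i \<omega>)) \<noteq> \<infinity>"
    by (intro nn_integral_PInf_AE) auto
  then show ?thesis by eventually_elim (auto intro: summable_suminf_not_top pos)
qed

text \<open>Cauchy condensation turns the series into a multiple of the sum of
  \<open>n powr (- b)\<close>.\<close>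

lemma summable_inverse_ln_powr:
  fixes b :: real
  assumes "b > 1"
  shows "summable (\<lambda>i. 1 / (real (i + 2) * ln (real (i + 2)) powr b))"
proof -
  \<comment> \<open>The values at 0 and 1 are set to the value at 2, since \<open>ln 1 = 0\<close>
    would break the monotonicity that condensation asks for.\<close>
  define f where "f n = (if n \<le> 1 then 1 / (2 * ln 2 powr b) else 1 / (real n * ln (real n) powr b))" for n :: nat
  have "f (Suc m) \<le> f m" if "0 < m" for m
  proof (cases "m = 1")
    case True then show ?thesis by (simp add: f_def)
  next
    case False
    then have m: "m \<ge> 2" using that by simp
    have "real m * ln (real m) powr b \<le> real (Suc m) * ln (real (Suc m)) powr b"
      using m assms by (intro mult_mono powr_mono2) auto
    then show ?thesis using m by (auto simp: f_def intro!: divide_left_mono mult_pos_pos)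
  qed
  moreover have "f n \<ge> 0" for n by (simp add: f_def)
  moreover have "summable (\<lambda>n. 2 ^ n * f (2 ^ n))"
  proof (rule summable_comparison_test_ev)
    show "\<forall>\<^sub>F n in sequentially. norm (2 ^ n * f (2 ^ n)) \<le> (ln 2 powr (-b)) * real n powr (-b)"
      using eventually_ge_at_top[of 1]
    proof eventually_elim
      case (elim n)
      then have "(2::nat) ^ n > 1" by (metis one_less_numeral_iff one_less_power semiring_norm(76) less_eq_Suc_le One_nat_def)
      then have "f (2 ^ n) = 1 / (2 ^ n * (real n * ln 2) powr b)"
        by (simp add: f_def ln_realpow)
      then have "2 ^ n * f (2 ^ n) = (ln 2 powr (-b)) * real n powr (-b)"
        using elim by (simp add: powr_mult powr_minus field_simps)
      then show ?case by (simp add: abs_mult)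
    qed
    show "summable (\<lambda>n. (ln 2 powr (-b)) * real n powr (-b))"
      using assms by (intro summable_mult) (simp add: summable_real_powr_iff)
  qed
  ultimately have "summable f" using condensation_test[of f] by blast
  then have "summable (\<lambda>i. f (i + 2))" by (subst summable_iff_shift)
  then show ?thesis by (simp add: f_def)
qed

text \<open>For every \<open>k\<close> with \<open>2 ^ r \<le> k < 2 ^ (r + 1)\<close>, one and the
  same energy of depth \<open>r + 1\<close> controls \<open>T k\<close>. It is therefore enough that
  the normalised energies are almost surely summable over \<open>r\<close>.\<close>

lemma quasi_orthogonal_AE_small:
  fixes T :: "nat \<Rightarrow> 'a \<Rightarrow> real" and b C :: real
  assumes int: "\<And>i j. i \<le> j \<Longrightarrow> integrable M (\<lambda>\<omega>. (T j \<omega> - T i \<omega>)\<^sup>2)"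
    and bnd: "\<And>i j. i \<le> j \<Longrightarrow> (\<integral>\<omega>. (T j \<omega> - T i \<omega>)\<^sup>2 \<partial>M) \<le> C * real (j - i)"
    and T0: "\<And>\<omega>. T 0 \<omega> = 0" and b: "b > 3/2"
  shows "AE \<omega> in M. (\<lambda>k. T k \<omega> / (sqrt (real k) * ln (real k) powr b)) \<longlonglongrightarrow> 0"
proof -
  \<comment> \<open>Up to the factor \<open>ln 2 powr (2 * b)\<close>, this bounds the square of the
    quotient for all \<open>k\<close> in block \<open>r\<close>: \<open>r + 2\<close> comes from the
    depth \<open>Suc r\<close>, and \<open>2 ^ r * r powr (2 * b)\<close> replaces
    \<open>k * ln k powr (2 * b)\<close>.\<close>
  define f where "f r \<omega> = real (r + 2) / (2 ^ r * real r powr (2 * b)) * dyadic_energy (\<lambda>k. T k \<omega>) (Suc r) 0" for r \<omega>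
  have C: "0 \<le> C"
    using order_trans[OF Bochner_Integration.integral_nonneg bnd[of 0 1]] by simp
  have "AE \<omega> in M. summable (\<lambda>r. f r \<omega>)"
  proof (rule AE_summable_nonneg)
    show "integrable M (f r)" for r
      unfolding f_def by (intro integrable_mult_right dyadic_energy_expectation(1)[OF int bnd])
    show "0 \<le> f r \<omega>" for r \<omega> by (simp add: f_def dyadic_energy_nonneg)
    show "summable (\<lambda>r. \<integral>\<omega>. f r \<omega> \<partial>M)"
    proof (rule summable_comparison_test_ev)
      show "\<forall>\<^sub>F r in sequentially. norm (\<integral>\<omega>. f r \<omega> \<partial>M) \<le> 18 * C * real r powr (2 - 2 * b)"
        using eventually_ge_at_top[of 1]
      proof eventually_elim
        case (elim r)
        have "norm (\<integral>\<omega>. f r \<omega> \<partial>M) = (\<integral>\<omega>. f r \<omega> \<partial>M)"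
          by (simp add: f_def dyadic_energy_nonneg)
        also have "\<dots> = real (r + 2) / (2 ^ r * real r powr (2 * b)) *
            (\<integral>\<omega>. dyadic_energy (\<lambda>k. T k \<omega>) (Suc r) 0 \<partial>M)"
          unfolding f_def by (rule integral_mult_right_zero)
        also have "\<dots> \<le> real (r + 2) / (2 ^ r * real r powr (2 * b)) * (C * (real (Suc (Suc r)) * 2 ^ Suc r))"
          by (intro mult_left_mono dyadic_energy_expectation(2)[OF int bnd]) auto
        also have "\<dots> = 2 * C * (real (r + 2) * real (r + 2)) / real r powr (2 * b)"
          by simp
        \<comment> \<open>\<open>r + 2 \<le> 3 * r\<close> for \<open>r \<ge> 1\<close>, whence 18 =
          2 * 3 * 3.\<close>
        also have "\<dots> \<le> 2 * C * ((3 * real r) * (3 * real r)) / real r powr (2 * b)"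
          using elim C by (intro divide_right_mono mult_left_mono mult_mono) auto
        also have "\<dots> = 18 * C * real r powr (2 - 2 * b)"
          using elim by (simp add: powr_diff powr_numeral power2_eq_square)
        finally show ?case .
      qed
      show "summable (\<lambda>r. 18 * C * real r powr (2 - 2 * b))"
        using b by (intro summable_mult) (simp add: summable_real_powr_iff)
    qed
  qed
  then show ?thesis
  proof eventually_elim
    case (elim \<omega>)
    then have f0: "(\<lambda>r. f r \<omega>) \<longlonglongrightarrow> 0" by (rule summable_LIMSEQ_zero)
    define c where "c = ln 2 powr (2 * b)"
    have c: "c > 0" by (simp add: c_def)
    show ?case
    proof (rule LIMSEQ_I)
      fix e :: real assume e: "e > 0"
      obtain R where R: "\<And>r. r \<ge> R \<Longrightarrow> \<bar>f r \<omega>\<bar> < e\<^sup>2 * c"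
        using LIMSEQ_D[OF f0, of "e\<^sup>2 * c"] e c by auto
      \<comment> \<open>The exponent \<open>Suc R\<close> forces \<open>r \<ge> 1\<close> below, so
        that \<open>r powr (2 * b)\<close> is positive.\<close>
      have "norm (T k \<omega> / (sqrt (real k) * ln (real k) powr b) - 0) < e"
        if k: "k \<ge> 2 ^ (Suc R)" for k
      proof -
        have "k > 0" using k by (metis gr0I not_less zero_less_numeral zero_less_power)
        then obtain r where r: "2 ^ r \<le> k" "k < 2 ^ (r + 1)"
          using ex_power_ivl1[of 2 k] \<open>k > 0\<close> by auto
        have rR: "r \<ge> R" "r \<ge> 1"
        proof -
          have "(2::nat) ^ (Suc R) < 2 ^ (r + 1)" using k r by linarith
          then have "Suc R < r + 1" by (metis power_strict_increasing_iff one_less_numeral_iff semiring_norm(76))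
          then show "r \<ge> R" "r \<ge> 1" by auto
        qed
        have kge: "real k \<ge> 2 ^ r" using r(1) by (metis of_nat_le_iff of_nat_numeral of_nat_power)
        have "ln (real k) \<ge> ln (2 ^ r)" using kge \<open>k > 0\<close> by (subst ln_le_cancel_iff) auto
        then have lnk: "ln (real k) \<ge> real r * ln 2" by (simp add: ln_realpow)
        have T: "(T k \<omega>)\<^sup>2 \<le> real (r + 2) * dyadic_energy (\<lambda>k. T k \<omega>) (Suc r) 0"
          using dyadic_energy_bound[of k "Suc r" "\<lambda>k. T k \<omega>" 0] r(2) T0 by simp
        have den: "2 ^ r * (real r powr (2 * b) * c) \<le> real k * ln (real k) powr (2 * b)"
        proof -
          have "real r powr (2 * b) * c = (real r * ln 2) powr (2 * b)"
            by (simp add: c_def powr_mult)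
          also have "\<dots> \<le> ln (real k) powr (2 * b)" using lnk b by (intro powr_mono2) auto
          finally show ?thesis using kge c by (intro mult_mono) auto
        qed
        have pos: "0 < 2 ^ r * (real r powr (2 * b) * c)" using rR c by simp
        have sq: "(sqrt (real k) * ln (real k) powr b)\<^sup>2 = real k * ln (real k) powr (2 * b)"
        proof -
          have "ln (real k) powr (2 * b) = (ln (real k) powr b)\<^sup>2"
            by (simp only: mult_2 powr_add power2_eq_square)
          then show ?thesis by (simp add: power_mult_distrib)
        qed
        have "(T k \<omega> / (sqrt (real k) * ln (real k) powr b))\<^sup>2 =
            (T k \<omega>)\<^sup>2 / (real k * ln (real k) powr (2 * b))"
          by (simp only: power_divide sq)
        also have "\<dots> \<le> (real (r + 2) * dyadic_energy (\<lambda>k. T k \<omega>) (Suc r) 0) / (2 ^ r * (real r powr (2 * b) * c))"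
          using T den pos by (intro frac_le) (auto simp: dyadic_energy_nonneg)
        also have "\<dots> = f r \<omega> / c" by (simp add: f_def)
        also have "\<dots> < e\<^sup>2" using R[OF rR(1)] c by (simp add: divide_less_eq abs_less_iff)
        finally have lt: "(T k \<omega> / (sqrt (real k) * ln (real k) powr b))\<^sup>2 < e\<^sup>2" .
        have "\<bar>T k \<omega> / (sqrt (real k) * ln (real k) powr b)\<bar> < e"
          by (rule power2_less_imp_less) (use lt e in \<open>simp_all only: power2_abs less_imp_le\<close>)
        then show ?thesis by simp
      qed
      then show "\<exists>no. \<forall>n\<ge>no. norm (T n \<omega> / (sqrt (real n) * ln (real n) powr b) - 0) < e" by blast
    qed
  qed
qed

lemma abel_summation:
  fixes W U :: "nat \<Rightarrow> 'a :: comm_ring"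
  shows "(\<Sum>i<n. W i * (U (Suc i) - U i)) = W n * U n - W 0 * U 0 + (\<Sum>i<n. (W i - W (Suc i)) * U (Suc i))"
  by (induction n) (auto simp: algebra_simps)

text \<open>Summation by parts moves the difference from \<open>T\<close> to the weights. The new
  series converges absolutely because \<open>E |T i| \<le> sqrt (C * i)\<close>, and the boundary
  term tends to 0 by \<open>quasi_orthogonal_AE_small\<close>.\<close>

lemma quasi_orthogonal_AE_summable:
  fixes T :: "nat \<Rightarrow> 'a \<Rightarrow> real" and b C :: real
  assumes M: "prob_space M" and meas: "\<And>i. T i \<in> borel_measurable M"
    and int: "\<And>i j. i \<le> j \<Longrightarrow> integrable M (\<lambda>\<omega>. (T j \<omega> - T i \<omega>)\<^sup>2)"
    and bnd: "\<And>i j. i \<le> j \<Longrightarrow> (\<integral>\<omega>. (T j \<omega> - T i \<omega>)\<^sup>2 \<partial>M) \<le> C * real (j - i)"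
    and T0: "\<And>\<omega>. T 0 \<omega> = 0" and b: "b > 3/2"
  shows "AE \<omega> in M. summable (\<lambda>i. (T (i + 3) \<omega> - T (i + 2) \<omega>) / (sqrt (real (i + 2)) * ln (real (i + 2)) powr b))"
proof -
  interpret prob_space M by (rule M)
  note [measurable] = meas
  \<comment> \<open>Starting at index 2 keeps \<open>ln\<close> away from 0, so the weights are
    positive and decreasing.\<close>
  define W where "W i = 1 / (sqrt (real (i + 2)) * ln (real (i + 2)) powr b)" for i :: nat
  have C: "0 \<le> C"
    using order_trans[OF Bochner_Integration.integral_nonneg bnd[of 0 1]] by simp
  have W: "W (Suc i) \<le> W i" for i
    unfolding W_def using b by (intro divide_left_mono mult_mono powr_mono2 mult_pos_pos) auto
  have W0: "W i \<ge> 0" for i by (simp add: W_def)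
  have int2: "integrable M (\<lambda>\<omega>. (T i \<omega>)\<^sup>2)" for i using int[of 0 i] by (simp add: T0)
  have int1: "integrable M (\<lambda>\<omega>. \<bar>T i \<omega>\<bar>)" for i
    using square_integrable_imp_integrable[OF _ int2[of i]] by auto
  \<comment> \<open>First moment against second moment, from the nonnegative variance of
    \<open>|T i|\<close>.\<close>
  have L1: "(\<integral>\<omega>. \<bar>T i \<omega>\<bar> \<partial>M) \<le> sqrt C * sqrt (real i)" for i
  proof -
    have "(\<integral>\<omega>. \<bar>T i \<omega>\<bar> \<partial>M)\<^sup>2 \<le> (\<integral>\<omega>. \<bar>T i \<omega>\<bar>\<^sup>2 \<partial>M)"
      using variance_positive[of "\<lambda>\<omega>. \<bar>T i \<omega>\<bar>"] variance_eq[OF int1[of i]] int2[of i] by simp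
    also have "\<dots> \<le> C * real i" using bnd[of 0 i] by (simp add: T0)
    finally show ?thesis by (metis real_le_rsqrt real_sqrt_mult)
  qed
  \<comment> \<open>Abel summation is read backwards, with square roots in place of
    \<open>T\<close>: decrements of \<open>W\<close> are traded for increments of
    \<open>sqrt\<close>, which are at most \<open>1 / sqrt (i + 2)\<close>. The terms then compare
    with \<open>1 / (j * ln j powr b)\<close>.\<close>
  have s1: "summable (\<lambda>i. (W i - W (Suc i)) * sqrt (real (i + 3)))"
  proof (rule summableI_nonneg_bounded)
    have sb: "summable (\<lambda>i. W i * (sqrt (real (i + 3)) - sqrt (real (i + 2))))"
    proof (rule summable_comparison_test)
      show "\<exists>N. \<forall>i\<ge>N. norm (W i * (sqrt (real (i + 3)) - sqrt (real (i + 2)))) \<le> 1 / (real (i + 2) * ln (real (i + 2)) powr b)"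
      proof (intro exI[of _ 0] allI impI)
        fix i :: nat
        have p: "sqrt (real (i + 2)) > 0" by simp
        have "(sqrt (real (i + 3)) - sqrt (real (i + 2))) * (sqrt (real (i + 3)) + sqrt (real (i + 2))) = 1"
          by (simp add: algebra_simps)
        moreover have "(sqrt (real (i + 3)) - sqrt (real (i + 2))) * sqrt (real (i + 2)) \<le>
          (sqrt (real (i + 3)) - sqrt (real (i + 2))) * (sqrt (real (i + 3)) + sqrt (real (i + 2)))"
          by (intro mult_left_mono) auto
        ultimately have q: "sqrt (real (i + 3)) - sqrt (real (i + 2)) \<le> 1 / sqrt (real (i + 2))"
          using p by (simp add: le_divide_eq)
        have "norm (W i * (sqrt (real (i + 3)) - sqrt (real (i + 2)))) = W i * (sqrt (real (i + 3)) - sqrt (real (i + 2)))"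
          using W0 by (simp add: abs_mult)
        also have "\<dots> \<le> W i * (1 / sqrt (real (i + 2)))" using W0 q by (intro mult_left_mono) auto
        also have "\<dots> = 1 / (real (i + 2) * ln (real (i + 2)) powr b)"
          by (simp add: W_def)
        finally show "norm (W i * (sqrt (real (i + 3)) - sqrt (real (i + 2)))) \<le> 1 / (real (i + 2) * ln (real (i + 2)) powr b)" .
      qed
      show "summable (\<lambda>i. 1 / (real (i + 2) * ln (real (i + 2)) powr b))"
        using b by (intro summable_inverse_ln_powr) auto
    qed
    show "0 \<le> (W i - W (Suc i)) * sqrt (real (i + 3))" for i using W[of i] by simp
    fix n
    have "(\<Sum>i<n. (W i - W (Suc i)) * sqrt (real (i + 3))) =
      (\<Sum>i<n. W i * (sqrt (real (i + 3)) - sqrt (real (i + 2)))) + W 0 * sqrt 2 - W n * sqrt (real (n + 2))"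
      using abel_summation[of W "\<lambda>i. sqrt (real (i + 2))" n] by (simp add: numeral_3_eq_3 algebra_simps)
    also have "\<dots> \<le> (\<Sum>i. W i * (sqrt (real (i + 3)) - sqrt (real (i + 2)))) + W 0 * sqrt 2"
    proof -
      have "(\<Sum>i<n. W i * (sqrt (real (i + 3)) - sqrt (real (i + 2)))) \<le>
          (\<Sum>i. W i * (sqrt (real (i + 3)) - sqrt (real (i + 2))))"
        using W0 by (intro sum_le_suminf[OF sb]) auto
      moreover have "W n * sqrt (real (n + 2)) \<ge> 0" using W0[of n] by simp
      ultimately show ?thesis by linarith
    qed
    finally show "(\<Sum>i<n. (W i - W (Suc i)) * sqrt (real (i + 3))) \<le>
      (\<Sum>i. W i * (sqrt (real (i + 3)) - sqrt (real (i + 2)))) + W 0 * sqrt 2" .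
  qed
  have "AE \<omega> in M. summable (\<lambda>i. (W i - W (Suc i)) * \<bar>T (i + 3) \<omega>\<bar>)"
  proof (rule AE_summable_nonneg)
    show "summable (\<lambda>i. \<integral>\<omega>. (W i - W (Suc i)) * \<bar>T (i + 3) \<omega>\<bar> \<partial>M)"
    proof (rule summable_comparison_test)
      show "summable (\<lambda>i. sqrt C * ((W i - W (Suc i)) * sqrt (real (i + 3))))"
        by (intro summable_mult s1)
      have "norm (\<integral>\<omega>. (W i - W (Suc i)) * \<bar>T (i + 3) \<omega>\<bar> \<partial>M) \<le> sqrt C * ((W i - W (Suc i)) * sqrt (real (i + 3)))" for i
        using mult_left_mono[OF L1[of "i+3"], of "W i - W (Suc i)"] W[of i]
        by (simp add: abs_mult mult_ac)
      then show "\<exists>N. \<forall>i\<ge>N. norm (\<integral>\<omega>. (W i - W (Suc i)) * \<bar>T (i + 3) \<omega>\<bar> \<partial>M) \<le> sqrt C * ((W i - W (Suc i)) * sqrt (real (i + 3)))"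
        by blast
    qed
  qed (use int1 W in auto)
  moreover have "AE \<omega> in M. (\<lambda>k. T k \<omega> / (sqrt (real k) * ln (real k) powr b)) \<longlonglongrightarrow> 0"
    by (rule quasi_orthogonal_AE_small[OF int bnd T0 b])
  ultimately show ?thesis
  proof eventually_elim
    case (elim \<omega>)
    have "(\<lambda>n. T (n + 2) \<omega> / (sqrt (real (n + 2)) * ln (real (n + 2)) powr b)) \<longlonglongrightarrow> 0"
      using elim(2) by (rule LIMSEQ_ignore_initial_segment)
    then have lim: "(\<lambda>n. W n * T (n + 2) \<omega>) \<longlonglongrightarrow> 0" by (simp add: W_def)
    have "summable (\<lambda>i. norm ((W i - W (Suc i)) * T (i + 3) \<omega>))"
      using elim(1) W by (simp add: abs_mult)
    then have s: "summable (\<lambda>i. (W i - W (Suc i)) * T (i + 3) \<omega>)" by (rule summable_norm_cancel)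
    have "(\<lambda>n. W n * T (n + 2) \<omega> - W 0 * T 2 \<omega> + (\<Sum>i<n. (W i - W (Suc i)) * T (i + 3) \<omega>)) \<longlonglongrightarrow>
       0 - W 0 * T 2 \<omega> + (\<Sum>i. (W i - W (Suc i)) * T (i + 3) \<omega>)"
      by (intro tendsto_intros lim summable_LIMSEQ s)
    moreover have "(\<Sum>i<n. W i * (T (i + 3) \<omega> - T (i + 2) \<omega>)) =
       W n * T (n + 2) \<omega> - W 0 * T 2 \<omega> + (\<Sum>i<n. (W i - W (Suc i)) * T (i + 3) \<omega>)" for n
      using abel_summation[of W "\<lambda>i. T (i + 2) \<omega>" n] by (simp add: eval_nat_numeral)
    ultimately have "(\<lambda>n. \<Sum>i<n. W i * (T (i + 3) \<omega> - T (i + 2) \<omega>)) \<longlonglongrightarrow>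
       0 - W 0 * T 2 \<omega> + (\<Sum>i. (W i - W (Suc i)) * T (i + 3) \<omega>)" by simp
    then have "summable (\<lambda>i. W i * (T (i + 3) \<omega> - T (i + 2) \<omega>))"
      unfolding summable_def sums_def by blast
    then show ?case by (simp add: W_def)
  qed
qed

section \<open>Characteristic functions of lattice distributions\<close>

text \<open>Both are moments of the centred normal density with variance \<open>1 / (2 * a)\<close>,
  up to the factor \<open>sqrt (pi / a)\<close>.\<close>

lemma gaussian_integrals:
  fixes a :: real
  assumes a: "a > 0"
  shows "has_bochner_integral lborel (\<lambda>t. exp (- (a * t\<^sup>2))) (sqrt (pi / a))"
    and "has_bochner_integral lborel (\<lambda>t. \<bar>t\<bar> * exp (- (a * t\<^sup>2))) (1 / a)"
proof -
  define s where "s = 1 / sqrt (2 * a)"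
  have s: "s > 0" "s\<^sup>2 = 1 / (2 * a)" using a by (auto simp: s_def power_divide)
  have nd: "sqrt (pi / a) * normal_density 0 s t = exp (- (a * t\<^sup>2))" for t
    using a by (simp add: normal_density_def s real_sqrt_divide field_simps)
  have "has_bochner_integral lborel (\<lambda>t. sqrt (pi / a) * normal_density 0 s t) (sqrt (pi / a) * 1)"
    using s(1) by (intro has_bochner_integral_mult_right) (auto simp: has_bochner_integral_iff)
  then show "has_bochner_integral lborel (\<lambda>t. exp (- (a * t\<^sup>2))) (sqrt (pi / a))"
    by (simp add: nd)
  have "has_bochner_integral lborel (\<lambda>t. sqrt (pi / a) * (normal_density 0 s t * \<bar>t - 0\<bar> ^ (2 * 0 + 1)))
      (sqrt (pi / a) * (2 ^ 0 * s ^ (2 * 0 + 1) * fact 0 * sqrt (2 / pi)))"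
    by (intro has_bochner_integral_mult_right normal_moment_abs_odd s(1))
  also have "sqrt (pi / a) * (2 ^ 0 * s ^ (2 * 0 + 1) * fact 0 * sqrt (2 / pi)) = 1 / a"
    using a by (simp add: s_def real_sqrt_divide real_sqrt_mult field_simps flip: power2_eq_square)
  also have "(\<lambda>t. sqrt (pi / a) * (normal_density 0 s t * \<bar>t - 0\<bar> ^ (2 * 0 + 1))) =
      (\<lambda>t. \<bar>t\<bar> * exp (- (a * t\<^sup>2)))"
    by (simp add: mult_ac flip: nd)
  finally show "has_bochner_integral lborel (\<lambda>t. \<bar>t\<bar> * exp (- (a * t\<^sup>2))) (1 / a)" .
qed

text \<open>Orthogonality of the characters of the lattice over one period of the dual
  variable.\<close>

lemma iexp_integral_dual_period:
  fixes D :: real and k :: int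
  assumes D: "D > 0"
  shows "(CLBINT t:{- pi / D .. pi / D}. iexp (t * (D * of_int k))) = (if k = 0 then 2 * pi / D else 0)"
proof (cases "k = 0")
  case True
  then show ?thesis
    using D by (simp add: set_lebesgue_integral_def scaleR_conv_of_real divide_le_eq)
next
  case False
  define z where "z = D * of_int k"
  have z: "z \<noteq> 0" using False D by (simp add: z_def)
  define F where "F t = iexp (t * z) / (\<i> * z)" for t :: real
  have "(CLBINT t:{- pi / D .. pi / D}. iexp (t * z)) = F (pi / D) - F (- pi / D)"
    unfolding set_lebesgue_integral_def
  proof (rule integral_FTC_atLeastAtMost)
    show "- pi / D \<le> pi / D" using D by (simp add: divide_le_eq)
    show "continuous_on {- pi / D..pi / D} (\<lambda>x. iexp (x * z))"
      by (intro continuous_intros)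
    fix x
    have "((\<lambda>w::complex. exp (\<i> * (w * z)) / (\<i> * z)) has_field_derivative iexp (x * z)) (at (of_real x))"
      using z by (auto intro!: derivative_eq_intros simp: field_simps)
    from has_vector_derivative_real_field[OF this]
    show "(F has_vector_derivative iexp (x * z)) (at x within {- pi / D..pi / D})"
      by (auto simp: F_def[abs_def])
  qed
  also have "iexp (pi / D * z) = iexp (- pi / D * z)"
  proof -
    have "iexp (pi / D * z) = exp (\<i> * of_real (- pi / D * z) + \<i> * (of_int k * (of_real pi * 2)))"
      using D by (simp add: z_def field_simps)
    also have "\<dots> = iexp (- pi / D * z)" by (rule exp_plus_2pin)
    finally show ?thesis .
  qed
  then have "F (pi / D) - F (- pi / D) = 0" by (simp add: F_def)
  finally show ?thesis using False by (simp add: z_def)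
qed

text \<open>After Fubini the inner integral over \<open>t\<close> vanishes at every lattice point
  other than \<open>y\<close>. The lattice is centred at \<open>y\<close> itself, so that
  \<open>x - y\<close> is directly an integer multiple of \<open>D\<close>.\<close>

lemma lattice_inversion:
  fixes \<nu> :: "real measure" and D y :: real
  assumes "real_distribution \<nu>" and D: "D > 0"
    and lat: "AE x in \<nu>. \<exists>k::int. x = y + D * of_int k"
  shows "(CLBINT t:{- pi / D .. pi / D}. iexp (- (t * y)) * char \<nu> t) = of_real (2 * pi / D * measure \<nu> {y})"
proof -
  interpret \<nu>: real_distribution \<nu> by fact
  interpret P: pair_sigma_finite lborel \<nu> ..
  let ?I = "{- pi / D .. pi / D}"
  let ?f = "\<lambda>(t, x). indicator ?I t *\<^sub>R iexp (t * (x - y))"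
  have "(CLBINT t:?I. iexp (- (t * y)) * char \<nu> t) = (CLBINT t. (CLINT x|\<nu>. ?f (t, x)))"
    unfolding set_lebesgue_integral_def char_def
    by (intro Bochner_Integration.integral_cong refl)
       (simp add: right_diff_distrib exp_diff exp_minus field_simps flip: integral_mult_right_zero)
  also have "\<dots> = (CLINT x|\<nu>. (CLBINT t. ?f (t, x)))"
  \<comment> \<open>The kernel has norm at most 1 and lives on a set of finite product measure,
    which justifies the exchange.\<close>
  proof (intro P.Fubini_integral[symmetric] integrableI_bounded_set[where A = "?I \<times> space \<nu>" and B = 1])
    show "emeasure (lborel \<Otimes>\<^sub>M \<nu>) (?I \<times> space \<nu>) < \<infinity>"
      using D by (subst \<nu>.emeasure_pair_measure_Times) (auto simp: \<nu>.emeasure_space_1[simplified])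
  qed (auto intro!: AE_I2 simp: indicator_def)
  also have "\<dots> = (CLINT x|\<nu>. indicator {y} x *\<^sub>R of_real (2 * pi / D))"
  proof (rule integral_cong_AE)
    show "AE x in \<nu>. (CLBINT t. ?f (t, x)) = indicator {y} x *\<^sub>R of_real (2 * pi / D)"
      using lat
    proof eventually_elim
      case (elim x)
      then obtain k :: int where "x = y + D * of_int k" ..
      then have k: "x - y = D * of_int k" by simp
      have "(CLBINT t. ?f (t, x)) = (CLBINT t:?I. iexp (t * (D * of_int k)))"
        by (simp only: set_lebesgue_integral_def k prod.case)
      also have "\<dots> = (if k = 0 then 2 * pi / D else 0)" by (rule iexp_integral_dual_period[OF D])
      also have "\<dots> = indicator {y} x *\<^sub>R of_real (2 * pi / D)"
        using D k by (auto simp: indicator_def)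
      finally show ?case .
    qed
  qed simp_all
  also have "\<dots> = of_real (2 * pi / D * measure \<nu> {y})"
    by (simp add: scaleR_conv_of_real)
  finally show ?thesis .
qed

text \<open>The Taylor remainder is at most \<open>x ^ 4 / 24\<close>, and
  \<open>|x| \<le> 2\<close> makes this at most \<open>x\<^sup>2 / 6\<close>, which leaves the
  coefficient 1/2 - 1/6 = 1/3.\<close>

lemma cos_le_quadratic:
  fixes x :: real
  assumes "\<bar>x\<bar> \<le> pi / 2"
  shows "cos x \<le> 1 - x\<^sup>2 / 3"
proof -
  obtain t where "cos x = (\<Sum>m<4. cos_coeff m * x ^ m) + (cos (t + 1/2 * real 4 * pi) / fact 4) * x ^ 4"
    using Maclaurin_cos_expansion[of x 4] by auto
  moreover have odd_three: "\<not> Suc (Suc 0) dvd Suc (Suc (Suc 0))" by presburger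
  ultimately have "cos x = 1 - x\<^sup>2 / 2 + cos (t + 1/2 * real 4 * pi) * (x ^ 4 / 24)"
    using odd_three by (simp add: cos_coeff_def numeral_eq_Suc fact_numeral)
  also have "\<dots> \<le> 1 - x\<^sup>2 / 2 + 1 * (x ^ 4 / 24)"
    by (intro add_left_mono mult_right_mono) auto
  also have "x ^ 4 \<le> 4 * x\<^sup>2"
  proof -
    have "\<bar>x\<bar> \<le> 2" using assms pi_less_4 by linarith
    then have "x\<^sup>2 \<le> 4" using power_mono[of "\<bar>x\<bar>" 2 2] by simp
    then have "x\<^sup>2 * x\<^sup>2 \<le> 4 * x\<^sup>2" by (intro mult_right_mono) auto
    then show ?thesis by (simp flip: power_add)
  qed
  finally show ?thesis by simp
qed

lemma norm_one_plus_iexp: "norm (1 + iexp x) = 2 * \<bar>cos (x / 2)\<bar>"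
proof -
  have "1 + iexp x = iexp (x / 2) * (2 * cos (x / 2))"
  proof -
    have "iexp x = iexp (x / 2) * iexp (x / 2)" by (simp flip: exp_add)
    moreover have "2 * complex_of_real (cos (x / 2)) = iexp (x / 2) + iexp (- (x / 2))"
      by (simp add: complex_eq_iff Re_exp Im_exp)
    moreover have "iexp (x / 2) * iexp (- (x / 2)) = 1" by (simp flip: exp_add)
    ultimately show ?thesis by (simp add: algebra_simps)
  qed
  then show ?thesis by (simp add: norm_mult)
qed

text \<open>Take mass \<open>p\<close> out of each of the two atoms. The remaining mass contributes
  at most \<open>1 - 2 * p\<close>, and the pair contributes
  \<open>2 * p * |cos (t * D / 2)|\<close>, which loses a quadratic amount on the whole period
  because \<open>|t * D / 2| \<le> pi / 2\<close> there.\<close>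

lemma char_bound_adjacent_atoms:
  fixes \<nu> :: "real measure" and D a p t :: real
  assumes "real_distribution \<nu>" and D: "D > 0" and p: "p > 0"
    and pa: "p \<le> measure \<nu> {a}" and pb: "p \<le> measure \<nu> {a + D}" and t: "\<bar>t\<bar> \<le> pi / D"
  shows "norm (char \<nu> t) \<le> exp (- (p * D\<^sup>2 / 6 * t\<^sup>2))"
proof -
  interpret \<nu>: real_distribution \<nu> by fact
  \<comment> \<open>With these fractions exactly \<open>p\<close> is removed from each atom, so both
    exponentials get the same coefficient and combine to \<open>1 + iexp (t * D)\<close>. The
    density \<open>w\<close> describes the rest.\<close>
  define q r where "q = p / measure \<nu> {a}" and "r = p / measure \<nu> {a + D}"
  have qr: "0 \<le> q" "q \<le> 1" "0 \<le> r" "r \<le> 1" "q * measure \<nu> {a} = p" "r * measure \<nu> {a + D} = p"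
    using p pa pb by (auto simp: q_def r_def)
  define w where "w x = 1 - q * indicator {a} x - r * indicator {a + D} x" for x :: real
  have w: "0 \<le> w x" "w x \<le> 1" for x using qr D by (auto simp: w_def indicator_def)
  have [measurable]: "w \<in> borel_measurable \<nu>" by (simp add: w_def[abs_def])
  have i1: "integrable \<nu> (\<lambda>x. iexp (t * x))"
    by (intro \<nu>.integrable_const_bound[where B = 1]) auto
  have iw: "integrable \<nu> w"
    using w by (intro \<nu>.integrable_const_bound[where B = 1]) auto
  have Ew: "(\<integral>x. w x \<partial>\<nu>) = 1 - 2 * p"
    unfolding w_def using qr
    by (simp add: \<nu>.prob_space[simplified] less_top[symmetric])
  have "(CLINT x|\<nu>. w x *\<^sub>R iexp (t * x)) =
      (CLINT x|\<nu>. iexp (t * x) - indicator {a} x *\<^sub>R (q * iexp (t * a)) - indicator {a + D} x *\<^sub>R (r * iexp (t * (a + D))))"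
    by (intro Bochner_Integration.integral_cong refl) (auto simp: w_def scaleR_conv_of_real algebra_simps split: split_indicator)
  also have "\<dots> = char \<nu> t - measure \<nu> {a} *\<^sub>R (q * iexp (t * a)) - measure \<nu> {a + D} *\<^sub>R (r * iexp (t * (a + D)))"
    using i1 by (simp add: char_def less_top[symmetric])
  also have "\<dots> = char \<nu> t - (of_real (q * measure \<nu> {a}) * iexp (t * a) + of_real (r * measure \<nu> {a + D}) * iexp (t * (a + D)))"
    by (simp add: scaleR_conv_of_real algebra_simps)
  also have "\<dots> = char \<nu> t - of_real p * iexp (t * a) * (1 + iexp (t * D))"
    by (simp only: qr) (simp add: algebra_simps exp_add)
  finally have eq: "char \<nu> t = (CLINT x|\<nu>. w x *\<^sub>R iexp (t * x)) + of_real p * iexp (t * a) * (1 + iexp (t * D))"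
    by simp
  have "norm (CLINT x|\<nu>. w x *\<^sub>R iexp (t * x)) \<le> (\<integral>x. norm (w x *\<^sub>R iexp (t * x)) \<partial>\<nu>)"
    by (rule integral_norm_bound)
  also have "\<dots> = 1 - 2 * p" using w by (simp add: Ew[symmetric])
  finally have n1: "norm (CLINT x|\<nu>. w x *\<^sub>R iexp (t * x)) \<le> 1 - 2 * p" .
  have "\<bar>t\<bar> * D \<le> pi" using t D by (simp add: le_divide_eq)
  then have x: "\<bar>t * D / 2\<bar> \<le> pi / 2" using D by (simp add: abs_mult)
  have "norm (of_real p * iexp (t * a) * (1 + iexp (t * D))) = p * (2 * \<bar>cos (t * D / 2)\<bar>)"
    using p by (simp add: norm_mult norm_one_plus_iexp del: of_real_mult)
  also have "\<bar>cos (t * D / 2)\<bar> = cos (t * D / 2)"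
    using x by (intro abs_of_nonneg cos_ge_zero) auto
  also have "\<dots> \<le> 1 - (t * D / 2)\<^sup>2 / 3" by (rule cos_le_quadratic[OF x])
  finally have n2: "norm (of_real p * iexp (t * a) * (1 + iexp (t * D))) \<le> p * (2 * (1 - (t * D / 2)\<^sup>2 / 3))"
    using p by simp
  have "norm (char \<nu> t) \<le> (1 - 2 * p) + p * (2 * (1 - (t * D / 2)\<^sup>2 / 3))"
    unfolding eq using n1 n2 by (intro norm_triangle_mono)
  also have "\<dots> = 1 + (- (p * D\<^sup>2 / 6 * t\<^sup>2))"
    by (simp add: field_simps power2_eq_square)
  also have "\<dots> \<le> exp (- (p * D\<^sup>2 / 6 * t\<^sup>2))" by (rule exp_ge_add_one_self)
  finally show ?thesis .
qed

text \<open>With the drift removed, \<open>|1 - \<psi>| \<le> 3/2 * V * t\<^sup>2\<close>, so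
  \<open>|1 - \<psi> ^ m|\<close> is bounded both by \<open>m\<close> times this and by 2. The
  geometric mean of the two bounds is linear in \<open>|t|\<close> and of order
  \<open>sqrt m\<close>, the scale on which \<open>m\<close> steps fluctuate.\<close>

lemma char_power_near_one:
  fixes \<nu> :: "real measure" and \<mu> V t :: real
  assumes "real_distribution \<nu>" and sq: "integrable \<nu> (\<lambda>x. x\<^sup>2)"
    and mean: "(\<integral>x. x \<partial>\<nu>) = \<mu>" and var: "(\<integral>x. (x - \<mu>)\<^sup>2 \<partial>\<nu>) = V"
  shows "norm (iexp (t * (real m * \<mu>)) - char \<nu> t ^ m) \<le> sqrt (3 * V) * sqrt (real m) * \<bar>t\<bar>"
proof -
  interpret \<nu>: real_distribution \<nu> by fact
  have i1: "integrable \<nu> (\<lambda>x. x)"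
    by (rule \<nu>.square_integrable_imp_integrable[OF _ sq]) auto
  have ic: "integrable \<nu> (\<lambda>x. (x - \<mu>) ^ k)" if "k \<le> 2" for k
  proof -
    have "k = 0 \<or> k = 1 \<or> k = 2" using that by auto
    then show ?thesis using i1 sq by (auto simp: power2_diff)
  qed
  have V: "V \<ge> 0" unfolding var[symmetric] by simp
  define \<psi> where "\<psi> = char (distr \<nu> borel (\<lambda>x. x - \<mu>)) t"
  have \<psi>: "\<psi> = iexp (- (t * \<mu>)) * char \<nu> t"
    unfolding \<psi>_def char_def
    by (subst integral_distr)
       (auto simp: right_diff_distrib exp_diff exp_minus field_simps simp flip: integral_mult_right_zero)
  have "(\<integral>x. x - \<mu> \<partial>\<nu>) = 0" using i1 mean by (simp add: \<nu>.prob_space[simplified])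
  then have s: "(\<Sum>k\<le>2. ((\<i> * t)^k / fact k) * (\<integral>x. (x - \<mu>) ^ k \<partial>\<nu>)) = 1 - t\<^sup>2 * V / 2"
    by (simp add: eval_nat_numeral \<nu>.prob_space[simplified] var[unfolded power2_eq_square])
       (simp add: power2_eq_square mult_ac)
  \<comment> \<open>Second-order expansion whose remainder uses only second moments; together with
    the quadratic term itself this gives 1/2 + 1 = 3/2.\<close>
  have "cmod (\<psi> - (\<Sum>k\<le>2. ((\<i> * t)^k / fact k) * (\<integral>x. (x - \<mu>) ^ k \<partial>\<nu>))) \<le>
     (2 * \<bar>t\<bar>^2 / fact 2) * (\<integral>x. \<bar>x - \<mu>\<bar> ^ 2 \<partial>\<nu>)"
    unfolding \<psi>_def by (rule \<nu>.char_approx1'[where X = "\<lambda>x. x - \<mu>"]) (auto intro: ic)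
  then have a: "cmod (\<psi> - (1 - t\<^sup>2 * V / 2)) \<le> t\<^sup>2 * V" unfolding s by (simp add: var)
  have "1 - \<psi> = (of_real (t\<^sup>2 * V / 2)) - (\<psi> - (1 - t\<^sup>2 * V / 2))" by simp
  then have "norm (1 - \<psi>) \<le> norm (complex_of_real (t\<^sup>2 * V / 2)) + norm (\<psi> - (1 - t\<^sup>2 * V / 2))"
    by (metis norm_triangle_ineq4)
  also have "\<dots> \<le> t\<^sup>2 * V / 2 + t\<^sup>2 * V" using a V by (intro add_mono) (auto simp del: of_real_mult of_real_divide of_real_power)
  finally have b: "norm (1 - \<psi>) \<le> 3/2 * (t\<^sup>2 * V)" by (simp add: mult.commute)
  have n1: "norm \<psi> \<le> 1" unfolding \<psi> using \<nu>.cmod_char_le_1[of t] by (simp add: norm_mult del: of_real_mult)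
  define z where "z = norm (1 ^ m - \<psi> ^ m)"
  have z1: "z \<le> real m * (3/2 * (t\<^sup>2 * V))"
    unfolding z_def
    by (rule order_trans[OF norm_power_diff mult_left_mono[OF b]]) (use n1 in auto)
  have "z \<le> norm (1 ^ m :: complex) + norm (\<psi> ^ m)" unfolding z_def by (rule norm_triangle_ineq4)
  also have "\<dots> \<le> 2" using n1 by (simp add: norm_power power_le_one)
  finally have z2: "z \<le> 2" .
  have z0: "z \<ge> 0" by (simp add: z_def)
  \<comment> \<open>The product of the bounds \<open>z2\<close> and \<open>z1\<close>; its square
    root is the geometric mean.\<close>
  have "z\<^sup>2 \<le> 2 * (real m * (3/2 * (t\<^sup>2 * V)))"
    unfolding power2_eq_square[of z] using z0 z1 z2 by (intro mult_mono) auto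
  then have "z \<le> sqrt (3 * V * real m * t\<^sup>2)" by (intro real_le_rsqrt) (simp add: mult_ac)
  also have "\<dots> = sqrt (3 * V) * sqrt (real m) * \<bar>t\<bar>" by (simp add: real_sqrt_mult)
  also have "z = norm (iexp (t * (real m * \<mu>)) - char \<nu> t ^ m)"
  proof -
    have "iexp (t * (real m * \<mu>)) = iexp (t * \<mu>) ^ m" by (simp add: mult_ac flip: exp_of_nat_mult)
    moreover have "char \<nu> t = iexp (t * \<mu>) * \<psi>" unfolding \<psi> by (simp add: exp_minus field_simps)
    ultimately have "iexp (t * (real m * \<mu>)) - char \<nu> t ^ m = iexp (t * \<mu>) ^ m * (1 ^ m - \<psi> ^ m)"
      by (simp only: power_mult_distrib) (simp add: algebra_simps)
    then show ?thesis by (simp add: z_def norm_mult norm_power del: of_real_mult)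
  qed
  finally show ?thesis .
qed

lemma norm_set_integral_le:
  fixes f :: "'a \<Rightarrow> 'b :: {banach, second_countable_topology}"
  assumes g: "integrable M g" and "\<And>x. 0 \<le> g x" and "\<And>x. x \<in> A \<Longrightarrow> norm (f x) \<le> g x"
  shows "norm (LINT x:A|M. f x) \<le> integral\<^sup>L M g"
proof -
  have "norm (LINT x:A|M. f x) \<le> (\<integral>x. norm (indicator A x *\<^sub>R f x) \<partial>M)"
    unfolding set_lebesgue_integral_def by (rule integral_norm_bound)
  also have "\<dots> \<le> integral\<^sup>L M g"
    using assms by (intro integral_mono'[OF g]) (auto simp: indicator_def)
  finally show ?thesis .
qed

section \<open>Covariances of the hitting indicators\<close>

lemma sum_inverse_sqrt_le: "(\<Sum>d\<in>{1..<m}. 1 / sqrt (real d)) \<le> 2 * sqrt (real m)"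
proof -
  have "(\<Sum>d\<in>{1..<Suc m}. 1 / sqrt (real d)) \<le> 2 * sqrt (real m)" for m
  proof (induction m)
    case (Suc m)
    have "1 = (sqrt (Suc m) - sqrt m) * (sqrt (Suc m) + sqrt m)" by (simp add: algebra_simps)
    also have "\<dots> \<le> (sqrt (Suc m) - sqrt m) * (2 * sqrt (Suc m))"
      by (intro mult_left_mono) auto
    finally have "1 \<le> 2 * (sqrt (Suc m) - sqrt m) * sqrt (Suc m)" by (simp only: mult_ac)
    then have "1 / sqrt (Suc m) \<le> 2 * (sqrt (Suc m) - sqrt m)"
      by (subst pos_divide_le_eq) simp_all
    then show ?case using Suc by simp
  qed simp
  from this[of "m - 1"] show ?thesis
    by (cases m) (auto intro: order_trans)
qed

text \<open>Telescoping against \<open>4 / sqrt d\<close>. The constant 4 leaves room for the crude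
  \<open>sqrt (d + 1) \<le> 3/2 * sqrt d\<close>, since 3/2 * 5/2 stays below 4.\<close>

lemma sum_inverse_powr_3_2_le:
  assumes "m \<ge> 1"
  shows "(\<Sum>d\<in>{m..<N}. 1 / (real d * sqrt (real d))) \<le> 4 / sqrt (real m)"
proof -
  have telescope: "1 / (real d * sqrt (real d)) \<le> 4 / sqrt (real d) - 4 / sqrt (real (Suc d))" if "d \<ge> 1" for d
  proof -
    define x y where "x = sqrt (real d)" and "y = sqrt (real (Suc d))"
    have x: "x > 0" "x\<^sup>2 = real d" and y: "y > 0" "y\<^sup>2 = x\<^sup>2 + 1" and xy: "x \<le> y"
      using that by (auto simp: x_def y_def)
    have "y\<^sup>2 \<le> (3/2 * x)\<^sup>2" using x(2) y that by (simp add: power_mult_distrib power_divide)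
    then have y32: "y \<le> 3/2 * x" using x by (meson power2_le_imp_le less_imp_le mult_nonneg_nonneg zero_le_divide_iff zero_le_numeral)
    have "(y - x) * (x + y) = 1" using y(2) by (simp add: power2_eq_square algebra_simps)
    then have yx: "y - x = 1 / (x + y)" using x(1) y(1) by (simp add: eq_divide_eq)
    have "y * (x + y) \<le> (3/2 * x) * (x + 3/2 * x)" using x(1) y(1) y32 by (intro mult_mono) auto
    also have "\<dots> \<le> 4 * (x * x)" by simp
    finally have "x * (y * (x + y)) \<le> x * (4 * (x * x))" using x by (intro mult_left_mono) auto
    then have "4 / (4 * (x * x) * x) \<le> 4 / (x * y * (x + y))"
      using x y by (intro divide_left_mono) (auto simp: mult_ac)
    also have "\<dots> = 4 * (y - x) / (x * y)" using x y by (simp add: yx)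
    also have "\<dots> = 4 / x - 4 / y" using x y by (simp add: field_simps)
    finally have le: "4 / (4 * (x * x) * x) \<le> 4 / x - 4 / y" .
    have e: "4 * (x * x) * x = 4 * (real d * sqrt (real d))" by (simp add: x_def)
    show ?thesis using le unfolding e unfolding x_def y_def by simp
  qed
  have "(\<Sum>d\<in>{m..<N}. 1 / (real d * sqrt (real d))) \<le> 4 / sqrt (real m) - 4 / sqrt (real N)" if "m \<le> N"
    using that
  proof (induction N rule: dec_induct)
    case (step n)
    then show ?case using step(1) assms \<open>m \<le> n\<close> telescope[of n] by simp
  qed simp
  then show ?thesis
    by (cases "m \<le> N") (auto intro: order_trans)
qed

text \<open>Telescoping with \<open>ln (1 + 1 / n) \<le> 1 / n\<close> and
  \<open>1 / (n + 1) \<le> ln ((n + 1) / n)\<close>; the index shift in the second inequality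
  produces the boundary terms \<open>1 / a - 1 / b\<close>.\<close>

lemma sum_harmonic_bounds:
  assumes "1 \<le> a" "a \<le> b"
  shows "ln (real b / real a) \<le> (\<Sum>n\<in>{a..<b}. 1 / real n)" (is ?A)
    and "(\<Sum>n\<in>{a..<b}. 1 / real n) \<le> ln (real b / real a) + 1 / real a - 1 / real b" (is ?B)
proof -
  have "?A \<and> ?B"
    using assms(2)
  proof (induction b rule: dec_induct)
    case base
    then show ?case using assms by simp
  next
    case (step n)
    have n: "n \<ge> 1" using step assms by simp
    have "ln (1 + 1 / real n) \<le> 1 / real n" by (rule ln_add_one_self_le_self) auto
    also have "1 + 1 / real n = (real (Suc n) / real a) / (real n / real a)" using n assms(1) by (simp add: field_simps)
    finally have u: "ln (real (Suc n) / real a) - ln (real n / real a) \<le> 1 / real n"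
      using n assms(1) by (simp add: ln_div)
    have "ln (1 + (- 1 / real (Suc n))) \<le> - 1 / real (Suc n)"
      using n by (intro ln_add_one_self_le_self2) (simp add: field_simps)
    also have "1 + (- 1 / real (Suc n)) = (real n / real a) / (real (Suc n) / real a)" using n assms(1) by (simp add: field_simps)
    finally have l: "1 / real (Suc n) \<le> ln (real (Suc n) / real a) - ln (real n / real a)"
      using n assms(1) by (simp add: ln_div)
    show ?case using step u l by simp
  qed
  then show ?A ?B by auto
qed

lemma sum_symmetric_square:
  fixes f :: "'i::linorder \<Rightarrow> 'i \<Rightarrow> real"
  assumes "finite A" and sym: "\<And>m n. f m n = f n m"
  shows "(\<Sum>m\<in>A. \<Sum>n\<in>A. f m n) = (\<Sum>m\<in>A. f m m + 2 * (\<Sum>n\<in>{n\<in>A. m < n}. f m n))"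
proof -
  have split: "(\<Sum>n\<in>A. f m n) = f m m + (\<Sum>n\<in>{n\<in>A. m < n}. f m n) + (\<Sum>n\<in>{n\<in>A. n < m}. f m n)" if "m \<in> A" for m
  proof -
    have "A = insert m ({n\<in>A. m < n} \<union> {n\<in>A. n < m})" using that by auto
    then have "(\<Sum>n\<in>A. f m n) = (\<Sum>n\<in>insert m ({n\<in>A. m < n} \<union> {n\<in>A. n < m}). f m n)" by simp
    also have "\<dots> = f m m + (\<Sum>n\<in>{n\<in>A. m < n} \<union> {n\<in>A. n < m}. f m n)"
      using assms(1) by (subst sum.insert) auto
    also have "(\<Sum>n\<in>{n\<in>A. m < n} \<union> {n\<in>A. n < m}. f m n) = (\<Sum>n\<in>{n\<in>A. m < n}. f m n) + (\<Sum>n\<in>{n\<in>A. n < m}. f m n)"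
      using assms(1) by (intro sum.union_disjoint) auto
    finally show ?thesis by simp
  qed
  have "(\<Sum>m\<in>A. \<Sum>n\<in>{n\<in>A. n < m}. f m n) = (\<Sum>m\<in>A. \<Sum>n\<in>{n\<in>A. m < n}. f n m)"
    by (rule sum.swap_restrict[OF assms(1,1)])
  also have "\<dots> = (\<Sum>m\<in>A. \<Sum>n\<in>{n\<in>A. m < n}. f m n)" by (simp add: sym)
  finally have "(\<Sum>m\<in>A. \<Sum>n\<in>{n\<in>A. n < m}. f m n) = (\<Sum>m\<in>A. \<Sum>n\<in>{n\<in>A. m < n}. f m n)" .
  then show ?thesis by (simp add: split sum.distrib sum_distrib_left[symmetric])
qed

lemma lattice_set_diff:
  assumes "x \<in> lattice_set a D" "y \<in> lattice_set b D"
  shows "x - y \<in> lattice_set (a - b) D"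
proof -
  obtain k l :: int where "x = a + D * of_int k" "y = b + D * of_int l"
    using assms by (auto simp: lattice_set_def)
  then have "x - y = (a - b) + D * of_int (k - l)" by (simp add: algebra_simps)
  then show ?thesis unfolding lattice_set_def by blast
qed

lemma lattice_set_sum:
  assumes "finite A" "\<And>i. i \<in> A \<Longrightarrow> f i \<in> lattice_set v D"
  shows "sum f A \<in> lattice_set (real (card A) * v) D"
  using assms
proof (induction A rule: finite_induct)
  case empty
  show ?case unfolding lattice_set_def by (auto intro!: image_eqI[where x = 0])
next
  case (insert i A)
  have "f i \<in> lattice_set v D" using insert.prems by simp
  then obtain k :: int where "f i = v + D * of_int k" by (auto simp: lattice_set_def)
  moreover have "sum f A \<in> lattice_set (real (card A) * v) D" using insert by simp
  then obtain l :: int where "sum f A = real (card A) * v + D * of_int l" by (auto simp: lattice_set_def)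
  ultimately have "sum f (insert i A) = real (card (insert i A)) * v + D * of_int (k + l)"
    using insert by (simp add: algebra_simps)
  then show ?case unfolding lattice_set_def by blast
qed

text \<open>The adjacent atoms enter only through the decay rate \<open>c\<close> in
  \<open>char_le\<close>, which is asked on a single period because the inversion integral runs over
  \<open>[- pi / D, pi / D]\<close>.\<close>

locale lattice_walk = prob_space M for M :: "'a measure" +
  fixes X :: "nat \<Rightarrow> 'a \<Rightarrow> real" and \<nu> :: "real measure" and v D \<mu> V c :: real
  assumes real_distribution_\<nu>: "real_distribution \<nu>"
    and indep_X: "indep_vars (\<lambda>_. borel) X {1..}"
    and distr_X: "\<And>i. i \<ge> 1 \<Longrightarrow> distr M borel (X i) = \<nu>"
    and D_pos: "D > 0"
    and lattice_\<nu>: "AE x in \<nu>. x \<in> lattice_set v D"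
    and square_integrable_\<nu>: "integrable \<nu> (\<lambda>x. x\<^sup>2)"
    and mean_\<nu>: "(\<integral>x. x \<partial>\<nu>) = \<mu>" and variance_\<nu>: "(\<integral>x. (x - \<mu>)\<^sup>2 \<partial>\<nu>) = V"
    and c_pos: "c > 0"
    and char_le: "\<And>t. \<bar>t\<bar> \<le> pi / D \<Longrightarrow> norm (char \<nu> t) \<le> exp (- (c * t\<^sup>2))"
begin

sublocale \<nu>: real_distribution \<nu> by (rule real_distribution_\<nu>)

lemma measurable_X [measurable]: "i \<ge> 1 \<Longrightarrow> X i \<in> borel_measurable M"
  using indep_X unfolding indep_vars_def by auto

text \<open>The inversion integral without its factor \<open>D / (2 * pi)\<close>. The length
  \<open>n\<close> and the target \<open>y\<close> vary independently, so that walks of different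
  lengths can be compared.\<close>

definition fourier :: "nat \<Rightarrow> real \<Rightarrow> complex" where
  "fourier n y = (CLBINT t:{- pi / D .. pi / D}. iexp (- (t * y)) * char \<nu> t ^ n)"

lemma measurable_sum_X: "A \<subseteq> {1..} \<Longrightarrow> (\<lambda>\<omega>. \<Sum>i\<in>A. X i \<omega>) \<in> borel_measurable M"
  by (intro borel_measurable_sum measurable_X) auto

text \<open>Stated for any finite block of indices, to serve for \<open>S_n\<close> and for the
  increments \<open>S_n - S_m\<close> alike.\<close>

lemma prob_sum_eq_fourier:
  assumes A: "finite A" "A \<subseteq> {1..}" and y: "y \<in> lattice_set (real (card A) * v) D"
  shows "complex_of_real (prob {\<omega> \<in> space M. (\<Sum>i\<in>A. X i \<omega>) = y}) = D / (2 * pi) * fourier (card A) y"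
proof -
  note [measurable] = measurable_sum_X[OF A(2)]
  let ?S = "\<lambda>\<omega>. \<Sum>i\<in>A. X i \<omega>"
  have "real_distribution (distr M borel ?S)" by (intro real_distribution_distr) simp
  moreover have "AE x in distr M borel ?S. \<exists>k::int. x = y + D * of_int k"
  proof -
    have "AE \<omega> in M. X i \<omega> \<in> lattice_set v D" if "i \<in> A" for i
    proof (rule AE_distrD[where f = "X i" and M' = borel and P = "\<lambda>x. x \<in> lattice_set v D"])
      show "X i \<in> M \<rightarrow>\<^sub>M borel" using A that by auto
      show "AE x in distr M borel (X i). x \<in> lattice_set v D"
        using A that by (subst distr_X) (auto intro: lattice_\<nu>)
    qed
    then have "AE \<omega> in M. \<forall>i\<in>A. X i \<omega> \<in> lattice_set v D"
      using A(1) by (intro AE_finite_allI)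
    then have "AE \<omega> in M. ?S \<omega> \<in> lattice_set (real (card A) * v) D"
      by eventually_elim (auto intro: lattice_set_sum[OF A(1)])
    then have "AE \<omega> in M. \<exists>k::int. ?S \<omega> = y + D * of_int k"
    proof eventually_elim
      case (elim \<omega>)
      from lattice_set_diff[OF elim y] obtain k :: int where "?S \<omega> - y = D * of_int k"
        by (auto simp: lattice_set_def)
      then show ?case by (intro exI[of _ k]) simp
    qed
    then show ?thesis by (subst AE_distr_iff) auto
  qed
  ultimately have "(CLBINT t:{- pi / D .. pi / D}. iexp (- (t * y)) * char (distr M borel ?S) t) =
      of_real (2 * pi / D * measure (distr M borel ?S) {y})"
    by (rule lattice_inversion[OF _ D_pos])
  moreover have "char (distr M borel ?S) t = char \<nu> t ^ card A" for t
  proof -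
    have "char (distr M borel ?S) t = (\<Prod>i\<in>A. char (distr M borel (X i)) t)"
      by (rule char_distr_sum[OF indep_vars_subset[OF indep_X A(2)]])
    also have "\<dots> = (\<Prod>i\<in>A. char \<nu> t)" using A by (intro prod.cong refl) (auto simp: distr_X)
    finally show ?thesis by simp
  qed
  moreover have "measure (distr M borel ?S) {y} = prob {\<omega> \<in> space M. ?S \<omega> = y}"
    by (subst measure_distr) (auto intro!: arg_cong[where f = prob])
  ultimately have "fourier (card A) y = of_real (2 * pi / D * prob {\<omega> \<in> space M. ?S \<omega> = y})"
    by (simp add: fourier_def)
  then show ?thesis using D_pos by simp
qed

lemma char_power_le: "\<bar>t\<bar> \<le> pi / D \<Longrightarrow> norm (char \<nu> t) ^ n \<le> exp (- ((c * real n) * t\<^sup>2))"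
  using power_mono[OF char_le, of t n] by (simp add: mult_ac flip: exp_of_nat_mult)

text \<open>On the period the integrand is below a Gaussian, whose integral over the whole line
  gives the local bound of order \<open>1 / sqrt n\<close>.\<close>

lemma norm_fourier_le:
  assumes "n \<ge> 1"
  shows "norm (fourier n y) \<le> sqrt (pi / c) / sqrt (real n)"
proof -
  have "norm (fourier n y) \<le> (\<integral>t. exp (- ((c * real n) * t\<^sup>2)) \<partial>lborel)"
    unfolding fourier_def
    using gaussian_integrals(1)[of "c * real n"] c_pos assms char_power_le
    by (intro norm_set_integral_le) (auto simp: norm_mult norm_power has_bochner_integral_iff abs_le_iff minus_le_iff simp del: of_real_mult)
  also have "\<dots> = sqrt (pi / (c * real n))"
    using gaussian_integrals(1)[of "c * real n"] c_pos assms by (simp add: has_bochner_integral_iff)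
  also have "\<dots> = sqrt (pi / c) / sqrt (real n)" by (simp add: real_sqrt_divide real_sqrt_mult)
  finally show ?thesis .
qed

lemma set_integrable_fourier:
  "set_integrable lborel {- pi / D .. pi / D} (\<lambda>t. iexp (- (t * y)) * char \<nu> t ^ n)"
  unfolding set_integrable_def
proof (rule integrableI_bounded_set_indicator[where B = 1])
  show "AE t in lborel. t \<in> {- pi / D .. pi / D} \<longrightarrow> norm (iexp (- (t * y)) * char \<nu> t ^ n) \<le> 1"
    using \<nu>.cmod_char_le_1 by (auto simp: norm_mult norm_power power_le_one simp del: of_real_mult)
qed (use D_pos in auto)

text \<open>The cancellation behind the covariance bound. The integrands share
  \<open>iexp (- (t * y)) * char \<nu> t ^ k\<close>; the other factor is at most
  \<open>L * |t|\<close>, and the first absolute Gaussian moment yields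
  \<open>1 / (c * k)\<close>.\<close>

lemma norm_fourier_diff_le:
  assumes "k \<ge> 1"
  shows "norm (fourier k (y - x) - fourier (k + m) y) \<le>
    (\<bar>x - real m * \<mu>\<bar> + sqrt (3 * V) * sqrt (real m)) / (c * real k)"
proof -
  let ?I = "{- pi / D .. pi / D}"
  define L where "L = \<bar>x - real m * \<mu>\<bar> + sqrt (3 * V) * sqrt (real m)"
  have V: "V \<ge> 0" unfolding variance_\<nu>[symmetric] by simp
  have L: "L \<ge> 0" using V by (simp add: L_def)
  have ck: "c * real k > 0" using c_pos assms by simp
  \<comment> \<open>Two errors add up: from \<open>x\<close> to the drift \<open>m * \<mu>\<close>,
    and from the pure drift to the characteristic function of \<open>m\<close> steps.\<close>
  have bound: "norm (iexp (t * x) - char \<nu> t ^ m) \<le> L * \<bar>t\<bar>" for t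
  proof -
    have "norm (iexp (t * x) - iexp (t * (real m * \<mu>))) = norm (iexp (t * (real m * \<mu>)) * (iexp (t * (x - real m * \<mu>)) - 1))"
      by (simp add: algebra_simps flip: exp_add)
    also have "\<dots> = norm (iexp (t * (x - real m * \<mu>)) - 1)" by (simp add: norm_mult del: of_real_mult)
    also have "\<dots> \<le> \<bar>t * (x - real m * \<mu>)\<bar>"
      using iexp_approx1[of "t * (x - real m * \<mu>)" 0] by simp
    finally have "norm (iexp (t * x) - iexp (t * (real m * \<mu>))) \<le> \<bar>x - real m * \<mu>\<bar> * \<bar>t\<bar>"
      by (simp add: abs_mult mult_ac)
    moreover have "norm (iexp (t * (real m * \<mu>)) - char \<nu> t ^ m) \<le> sqrt (3 * V) * sqrt (real m) * \<bar>t\<bar>"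
      by (rule char_power_near_one[OF real_distribution_\<nu> square_integrable_\<nu> mean_\<nu> variance_\<nu>])
    ultimately show ?thesis
      using norm_triangle_ineq[of "iexp (t * x) - iexp (t * (real m * \<mu>))" "iexp (t * (real m * \<mu>)) - char \<nu> t ^ m"]
      by (simp add: L_def algebra_simps)
  qed
  have "fourier k (y - x) - fourier (k + m) y =
      (CLBINT t:?I. iexp (- (t * (y - x))) * char \<nu> t ^ k - iexp (- (t * y)) * char \<nu> t ^ (k + m))"
    unfolding fourier_def by (intro set_integral_diff(2)[symmetric] set_integrable_fourier)
  also have "norm \<dots> \<le> (\<integral>t. L * (\<bar>t\<bar> * exp (- ((c * real k) * t\<^sup>2))) \<partial>lborel)"
  proof (rule norm_set_integral_le)
    show "integrable lborel (\<lambda>t. L * (\<bar>t\<bar> * exp (- ((c * real k) * t\<^sup>2))))"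
      using gaussian_integrals(2)[OF ck] by (auto simp: has_bochner_integral_iff)
    show "0 \<le> L * (\<bar>t\<bar> * exp (- ((c * real k) * t\<^sup>2)))" for t using L by simp
    fix t assume "t \<in> ?I"
    then have t: "\<bar>t\<bar> \<le> pi / D" by (auto simp: abs_le_iff)
    have "iexp (- (t * (y - x))) * char \<nu> t ^ k - iexp (- (t * y)) * char \<nu> t ^ (k + m) =
        iexp (- (t * y)) * char \<nu> t ^ k * (iexp (t * x) - char \<nu> t ^ m)"
      by (simp add: algebra_simps power_add exp_diff exp_minus divide_inverse)
    then have "norm (iexp (- (t * (y - x))) * char \<nu> t ^ k - iexp (- (t * y)) * char \<nu> t ^ (k + m)) =
        norm (char \<nu> t) ^ k * norm (iexp (t * x) - char \<nu> t ^ m)"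
      by (simp add: norm_mult norm_power del: of_real_mult of_real_minus)
    also have "\<dots> \<le> exp (- ((c * real k) * t\<^sup>2)) * (L * \<bar>t\<bar>)"
      by (intro mult_mono char_power_le[OF t] bound) auto
    finally show "norm (iexp (- (t * (y - x))) * char \<nu> t ^ k - iexp (- (t * y)) * char \<nu> t ^ (k + m)) \<le>
        L * (\<bar>t\<bar> * exp (- ((c * real k) * t\<^sup>2)))" by (simp add: mult_ac)
  qed
  also have "\<dots> = L / (c * real k)"
    using gaussian_integrals(2)[OF ck] by (simp add: has_bochner_integral_iff)
  finally show ?thesis by (simp add: L_def)
qed

end

text \<open>Targets within \<open>B * sqrt n\<close> of the drift make both terms of
  \<open>norm_fourier_diff_le\<close>, taken at \<open>x = y m\<close>, of order
  \<open>sqrt m\<close>.\<close>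

locale lattice_walk_points = lattice_walk +
  fixes y :: "nat \<Rightarrow> real" and B :: real
  assumes y_lattice: "\<And>n. n \<ge> 1 \<Longrightarrow> y n \<in> lattice_set (real n * v) D"
    and y_dist: "\<And>n. n \<ge> 1 \<Longrightarrow> \<bar>y n - real n * \<mu>\<bar> \<le> B * sqrt (real n)"
begin

section \<open>Hitting indicators and their covariances\<close>

definition hit :: "nat \<Rightarrow> 'a \<Rightarrow> real" where
  "hit n \<omega> = of_bool ((\<Sum>i=1..n. X i \<omega>) = y n)"

definition hit_prob :: "nat \<Rightarrow> real" where
  "hit_prob n = prob {\<omega> \<in> space M. (\<Sum>i=1..n. X i \<omega>) = y n}"

text \<open>With the weight \<open>1 / sqrt n\<close> the subtracted mean is \<open>O(1/n)\<close>,
  the scale of a logarithmic average, and the second moment is at most \<open>1/n\<close>.\<close>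

definition Z :: "nat \<Rightarrow> 'a \<Rightarrow> real" where
  "Z n \<omega> = (hit n \<omega> - hit_prob n) / sqrt (real n)"

lemma measurable_partial_sum [measurable]: "(\<lambda>\<omega>. \<Sum>i=Suc m..n. X i \<omega>) \<in> borel_measurable M"
  by (rule measurable_sum_X) auto

lemma measurable_hit [measurable]: "hit n \<in> borel_measurable M"
  unfolding hit_def[abs_def] by simp

lemma measurable_Z [measurable]: "Z n \<in> borel_measurable M"
  unfolding Z_def[abs_def] by simp

lemma hit_bounds: "0 \<le> hit n \<omega>" "hit n \<omega> \<le> 1" by (auto simp: hit_def)

lemma hit_prob_bounds: "0 \<le> hit_prob n" "hit_prob n \<le> 1" by (auto simp: hit_prob_def)

lemma integrable_hit: "integrable M (hit n)"
  using hit_bounds by (intro integrable_const_bound[where B = 1]) auto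

lemma integrable_hit_mult: "integrable M (\<lambda>\<omega>. hit m \<omega> * hit n \<omega>)"
  using hit_bounds by (intro integrable_const_bound[where B = 1]) (auto intro!: mult_le_one)

lemma expectation_hit: "expectation (hit n) = hit_prob n"
proof -
  have "expectation (hit n) = expectation (indicator {\<omega> \<in> space M. (\<Sum>i=1..n. X i \<omega>) = y n})"
    by (intro Bochner_Integration.integral_cong refl) (auto simp: hit_def indicator_def)
  then show ?thesis by (simp add: hit_prob_def)
qed

lemma Z_abs_le: "n \<ge> 1 \<Longrightarrow> \<bar>Z n \<omega>\<bar> \<le> 1 / sqrt (real n)"
  using hit_bounds[of n \<omega>] hit_prob_bounds[of n]
  by (auto simp: Z_def abs_divide intro!: divide_right_mono)

lemma integrable_Z_mult: "integrable M (\<lambda>\<omega>. Z m \<omega> * Z n \<omega>)"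
proof -
  have "integrable M (\<lambda>\<omega>. (hit m \<omega> * hit n \<omega> - hit_prob n * hit m \<omega> - hit_prob m * hit n \<omega> + hit_prob m * hit_prob n) / (sqrt (real m) * sqrt (real n)))"
    using integrable_hit integrable_hit_mult by simp
  then show ?thesis by (simp add: Z_def algebra_simps)
qed

lemma prob_sum_le:
  assumes "finite A" "A \<subseteq> {1..}" "x \<in> lattice_set (real (card A) * v) D" "card A \<ge> 1"
  shows "prob {\<omega> \<in> space M. (\<Sum>i\<in>A. X i \<omega>) = x} \<le> D / (2 * pi) * sqrt (pi / c) / sqrt (real (card A))"
proof -
  have "prob {\<omega> \<in> space M. (\<Sum>i\<in>A. X i \<omega>) = x} =
      norm (complex_of_real (prob {\<omega> \<in> space M. (\<Sum>i\<in>A. X i \<omega>) = x}))" by simp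
  also have "\<dots> = D / (2 * pi) * norm (fourier (card A) x)"
    using D_pos by (simp add: prob_sum_eq_fourier[OF assms(1-3)] norm_mult norm_divide)
  also have "\<dots> \<le> D / (2 * pi) * (sqrt (pi / c) / sqrt (real (card A)))"
    using D_pos by (intro mult_left_mono norm_fourier_le[OF assms(4)]) auto
  finally show ?thesis by simp
qed

definition hit_const :: real where "hit_const = D / (2 * pi) * sqrt (pi / c)"

text \<open>Writing \<open>|B|\<close> makes the constant visibly nonnegative; the locale states no
  sign for \<open>B\<close>.\<close>

definition diff_const :: real where "diff_const = D / (2 * pi) * (\<bar>B\<bar> + sqrt (3 * V)) / c"

lemma const_nonneg: "0 \<le> hit_const" "0 \<le> diff_const"
proof -
  have "0 \<le> V" unfolding variance_\<nu>[symmetric] by simp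
  then show "0 \<le> hit_const" "0 \<le> diff_const" using D_pos c_pos by (auto simp: hit_const_def diff_const_def)
qed

lemma hit_prob_le: "n \<ge> 1 \<Longrightarrow> hit_prob n \<le> hit_const / sqrt (real n)"
  using prob_sum_le[of "{1..n}" "y n"] y_lattice[of n] by (simp add: hit_prob_def hit_const_def)

definition incr_prob :: "nat \<Rightarrow> nat \<Rightarrow> real" where
  "incr_prob m n = prob {\<omega> \<in> space M. (\<Sum>i=Suc m..n. X i \<omega>) = y n - y m}"

lemma incr_lattice:
  assumes "1 \<le> m" "m < n"
  shows "y n - y m \<in> lattice_set (real (card {Suc m..n}) * v) D"
  using lattice_set_diff[OF y_lattice[of n] y_lattice[of m]] assms
  by (simp add: left_diff_distrib of_nat_diff)

lemma incr_prob_le: 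
  assumes "1 \<le> m" "m < n"
  shows "incr_prob m n \<le> hit_const / sqrt (real (n - m))"
  using prob_sum_le[of "{Suc m..n}" "y n - y m"] incr_lattice[OF assms] assms
  by (simp add: incr_prob_def hit_const_def)

text \<open>No cancellation: both probabilities are nonnegative, and each is at most the right-hand
  side, as \<open>n - m \<le> n\<close>.\<close>

lemma incr_prob_diff_le1:
  assumes "1 \<le> m" "m < n"
  shows "\<bar>incr_prob m n - hit_prob n\<bar> \<le> hit_const / sqrt (real (n - m))"
proof -
  have "hit_prob n \<le> hit_const / sqrt (real n)" using assms by (intro hit_prob_le) auto
  also have "\<dots> \<le> hit_const / sqrt (real (n - m))"
    using assms const_nonneg by (intro divide_left_mono) auto
  finally have "hit_prob n \<le> hit_const / sqrt (real (n - m))" .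
  moreover have "0 \<le> incr_prob m n" by (simp add: incr_prob_def)
  ultimately show ?thesis using incr_prob_le[OF assms] hit_prob_bounds(1)[of n] by (simp add: abs_le_iff)
qed

text \<open>The increment is a walk of \<open>n - m\<close> steps aimed at \<open>y n - y m\<close>;
  passing to \<open>n\<close> steps aimed at \<open>y n\<close> costs
  \<open>norm_fourier_diff_le\<close> with \<open>x = y m\<close>.\<close>

lemma incr_prob_diff_le2:
  assumes "1 \<le> m" "m < n"
  shows "\<bar>incr_prob m n - hit_prob n\<bar> \<le> diff_const * sqrt (real m) / real (n - m)"
proof -
  have n: "n - m + m = n" using assms by simp
  have 1: "complex_of_real (incr_prob m n) = D / (2 * pi) * fourier (n - m) (y n - y m)"
    using prob_sum_eq_fourier[OF _ _ incr_lattice[OF assms]] by (simp add: incr_prob_def)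
  have 2: "complex_of_real (hit_prob n) = D / (2 * pi) * fourier n (y n)"
    using prob_sum_eq_fourier[of "{1..n}" "y n"] y_lattice[of n] assms by (simp add: hit_prob_def)
  have "\<bar>incr_prob m n - hit_prob n\<bar> = norm (complex_of_real (incr_prob m n) - complex_of_real (hit_prob n))"
    by (simp flip: of_real_diff)
  also have "\<dots> = norm (complex_of_real (D / (2 * pi)) * (fourier (n - m) (y n - y m) - fourier (n - m + m) (y n)))"
    unfolding 1 2 n by (simp only: right_diff_distrib)
  also have "\<dots> = D / (2 * pi) * norm (fourier (n - m) (y n - y m) - fourier (n - m + m) (y n))"
    using D_pos by (simp add: norm_mult norm_divide)
  also have "\<dots> \<le> D / (2 * pi) * ((\<bar>y m - real m * \<mu>\<bar> + sqrt (3 * V) * sqrt (real m)) / (c * real (n - m)))"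
    using assms D_pos by (intro mult_left_mono norm_fourier_diff_le) auto
  also have "\<dots> \<le> D / (2 * pi) * ((\<bar>B\<bar> * sqrt (real m) + sqrt (3 * V) * sqrt (real m)) / (c * real (n - m)))"
  proof -
    have "B * sqrt (real m) \<le> \<bar>B\<bar> * sqrt (real m)" by (intro mult_right_mono) auto
    then have "\<bar>y m - real m * \<mu>\<bar> \<le> \<bar>B\<bar> * sqrt (real m)" using y_dist[OF assms(1)] by linarith
    then show ?thesis using D_pos c_pos by (intro mult_left_mono divide_right_mono add_right_mono) auto
  qed
  also have "\<dots> = diff_const * sqrt (real m) / real (n - m)"
    using c_pos by (simp add: diff_const_def field_simps)
  finally show ?thesis .
qed

text \<open>Given a hit at \<open>m\<close>, a hit at \<open>n\<close> means that the increment
  equals \<open>y n - y m\<close>, and the increment uses a disjoint block of steps.\<close>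

lemma expectation_hit_mult:
  assumes "1 \<le> m" "m < n"
  shows "expectation (\<lambda>\<omega>. hit m \<omega> * hit n \<omega>) = hit_prob m * incr_prob m n"
proof -
  let ?A = "{1..m}" and ?B = "{Suc m..n}"
  have "indep_var (PiM ?A (\<lambda>_. borel)) (\<lambda>\<omega>. restrict (\<lambda>i. X i \<omega>) ?A) (PiM ?B (\<lambda>_. borel)) (\<lambda>\<omega>. restrict (\<lambda>i. X i \<omega>) ?B)"
    by (rule indep_var_restrict[OF indep_X]) auto
  then have "indep_var borel ((\<lambda>f. \<Sum>i\<in>?A. f i) \<circ> (\<lambda>\<omega>. restrict (\<lambda>i. X i \<omega>) ?A))
      borel ((\<lambda>f. \<Sum>i\<in>?B. f i) \<circ> (\<lambda>\<omega>. restrict (\<lambda>i. X i \<omega>) ?B))"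
    by (rule indep_var_compose) (auto intro!: borel_measurable_sum measurable_component_singleton)
  then have ind: "indep_var borel (\<lambda>\<omega>. \<Sum>i\<in>?A. X i \<omega>) borel (\<lambda>\<omega>. \<Sum>i\<in>?B. X i \<omega>)"
    by (simp add: comp_def)
  have "(\<Sum>i=1..n. X i \<omega>) = (\<Sum>i=1..m. X i \<omega>) + (\<Sum>i=Suc m..n. X i \<omega>)" for \<omega>
    using assms sum.ub_add_nat[of 1 m "\<lambda>i. X i \<omega>" "n - m"] by simp
  then have "expectation (\<lambda>\<omega>. hit m \<omega> * hit n \<omega>) =
      expectation (indicator {\<omega> \<in> space M. (\<Sum>i\<in>?A. X i \<omega>) \<in> {y m} \<and> (\<Sum>i\<in>?B. X i \<omega>) \<in> {y n - y m}})"
    by (intro Bochner_Integration.integral_cong refl) (auto simp: hit_def indicator_def)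
  also have "\<dots> = prob {\<omega> \<in> space M. (\<Sum>i\<in>?A. X i \<omega>) \<in> {y m} \<and> (\<Sum>i\<in>?B. X i \<omega>) \<in> {y n - y m}}"
    by simp
  also have "\<dots> = hit_prob m * incr_prob m n"
    by (subst prob_indep_random_variable[OF ind]) (auto simp: hit_prob_def incr_prob_def)
  finally show ?thesis .
qed

lemma covariance_eq:
  assumes "1 \<le> m" "m < n"
  shows "expectation (\<lambda>\<omega>. Z m \<omega> * Z n \<omega>) =
    hit_prob m * (incr_prob m n - hit_prob n) / (sqrt (real m) * sqrt (real n))"
proof -
  have "expectation (\<lambda>\<omega>. Z m \<omega> * Z n \<omega>) = expectation (\<lambda>\<omega>. (hit m \<omega> * hit n \<omega> - hit_prob n * hit m \<omega> - hit_prob m * hit n \<omega> + hit_prob m * hit_prob n) / (sqrt (real m) * sqrt (real n)))"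
    by (intro Bochner_Integration.integral_cong refl) (simp add: Z_def algebra_simps)
  also have "\<dots> = (expectation (\<lambda>\<omega>. hit m \<omega> * hit n \<omega>) - hit_prob n * expectation (hit m) - hit_prob m * expectation (hit n) + hit_prob m * hit_prob n) / (sqrt (real m) * sqrt (real n))"
    using integrable_hit integrable_hit_mult by (simp add: prob_space)
  also have "\<dots> = hit_prob m * (incr_prob m n - hit_prob n) / (sqrt (real m) * sqrt (real n))"
    by (simp add: expectation_hit expectation_hit_mult[OF assms] algebra_simps)
  finally show ?thesis .
qed

definition cov_const :: real where "cov_const = hit_const * (hit_const + diff_const)"

text \<open>For \<open>n < 2m\<close> the two probabilities are bounded separately; for \<open>n \<ge> 2m\<close> the cancellation between them is
  needed to make the row sums of order \<open>1/m\<close>.\<close>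

lemma covariance_le:
  assumes "1 \<le> m" "m < n"
  shows "\<bar>expectation (\<lambda>\<omega>. Z m \<omega> * Z n \<omega>)\<bar> \<le>
    cov_const * (if n - m < m then 1 / (real m * sqrt (real m)) * (1 / sqrt (real (n - m)))
         else 1 / sqrt (real m) * (1 / (real (n - m) * sqrt (real (n - m)))))"
proof -
  define d where "d = n - m"
  have d: "d \<ge> 1" "n \<ge> d" "n \<ge> m" using assms by (auto simp: d_def)
  have "\<bar>expectation (\<lambda>\<omega>. Z m \<omega> * Z n \<omega>)\<bar> =
      hit_prob m * \<bar>incr_prob m n - hit_prob n\<bar> / (sqrt (real m) * sqrt (real n))"
    using hit_prob_bounds by (simp add: covariance_eq[OF assms] abs_mult abs_divide)
  also have "\<dots> \<le> (hit_const / sqrt (real m)) * \<bar>incr_prob m n - hit_prob n\<bar> / (sqrt (real m) * sqrt (real n))"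
    using assms by (intro divide_right_mono mult_right_mono hit_prob_le) auto
  also have "\<dots> = hit_const / real m * (\<bar>incr_prob m n - hit_prob n\<bar> / sqrt (real n))"
    by (simp flip: mult.assoc)
  finally have le: "\<bar>expectation (\<lambda>\<omega>. Z m \<omega> * Z n \<omega>)\<bar> \<le> hit_const / real m * (\<bar>incr_prob m n - hit_prob n\<bar> / sqrt (real n))" .
  have KK: "hit_const * hit_const \<le> cov_const" "hit_const * diff_const \<le> cov_const" using const_nonneg by (auto simp: cov_const_def algebra_simps)
  show ?thesis
  proof (cases "d < m")
    case True
    \<comment> \<open>\<open>sqrt n\<close> is bounded below by \<open>sqrt m\<close> here, and by
      \<open>sqrt d\<close> in the other case.\<close>
    have "\<bar>incr_prob m n - hit_prob n\<bar> / sqrt (real n) \<le> (hit_const / sqrt (real d)) / sqrt (real m)"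
      using incr_prob_diff_le1[OF assms] d assms const_nonneg unfolding d_def[symmetric]
      by (intro frac_le) auto
    then have "hit_const / real m * (\<bar>incr_prob m n - hit_prob n\<bar> / sqrt (real n)) \<le> hit_const / real m * ((hit_const / sqrt (real d)) / sqrt (real m))"
      using const_nonneg by (intro mult_left_mono) auto
    also have "\<dots> = hit_const * hit_const * (1 / (real m * sqrt (real m)) * (1 / sqrt (real d)))" by simp
    also have "\<dots> \<le> cov_const * (1 / (real m * sqrt (real m)) * (1 / sqrt (real d)))"
      using KK by (intro mult_right_mono) auto
    finally show ?thesis using le True by (simp add: d_def[symmetric])
  next
    case False
    have "\<bar>incr_prob m n - hit_prob n\<bar> / sqrt (real n) \<le> (diff_const * sqrt (real m) / real d) / sqrt (real d)"
      using incr_prob_diff_le2[OF assms] d assms const_nonneg unfolding d_def[symmetric]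
      by (intro frac_le) auto
    then have "hit_const / real m * (\<bar>incr_prob m n - hit_prob n\<bar> / sqrt (real n)) \<le> hit_const / real m * ((diff_const * sqrt (real m) / real d) / sqrt (real d))"
      using const_nonneg by (intro mult_left_mono) auto
    also have "\<dots> = hit_const * diff_const * ((sqrt (real m) / real m) * (1 / (real d * sqrt (real d))))" by simp
    also have "sqrt (real m) / real m = 1 / sqrt (real m)"
      by (simp add: real_div_sqrt divide_simps)
    also have "hit_const * diff_const * (1 / sqrt (real m) * (1 / (real d * sqrt (real d)))) \<le> cov_const * (1 / sqrt (real m) * (1 / (real d * sqrt (real d))))"
      using KK by (intro mult_right_mono) auto
    finally show ?thesis using le False by (simp add: d_def[symmetric])
  qed
qed

text \<open>The near range gives \<open>1 / (m * sqrt m)\<close> times \<open>2 * sqrt m\<close>,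
  the far range \<open>1 / sqrt m\<close> times \<open>4 / sqrt m\<close>; together
  \<open>6 / m\<close>, uniformly in the finite set.\<close>

lemma covariance_row_sum_le:
  assumes m: "1 \<le> m" and A: "finite A"
  shows "(\<Sum>n\<in>{n\<in>A. m < n}. expectation (\<lambda>\<omega>. Z m \<omega> * Z n \<omega>)) \<le> 6 * cov_const / real m"
proof -
  define g where "g d = (if d < m then 1 / (real m * sqrt (real m)) * (1 / sqrt (real d))
     else 1 / sqrt (real m) * (1 / (real d * sqrt (real d))))" for d :: nat
  have g0: "g d \<ge> 0" for d by (simp add: g_def)
  have K0: "cov_const \<ge> 0" using const_nonneg by (simp add: cov_const_def)
  \<comment> \<open>Inserting \<open>m\<close> guarantees \<open>m \<le> N\<close>, so that the
    distances below \<open>N\<close> can be split at \<open>m\<close>.\<close>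
  define N where "N = Suc (Max (insert m A))"
  have N: "n < N" if "n \<in> A" for n using that A by (simp add: N_def less_Suc_eq_le)
  have mN: "m \<le> N" using A by (simp add: N_def le_SucI)
  have "(\<Sum>n\<in>{n\<in>A. m < n}. expectation (\<lambda>\<omega>. Z m \<omega> * Z n \<omega>)) \<le> (\<Sum>n\<in>{n\<in>A. m < n}. cov_const * g (n - m))"
    unfolding g_def by (intro sum_mono order_trans[OF abs_ge_self covariance_le[OF m]]) simp
  also have "\<dots> = cov_const * (\<Sum>d\<in>(\<lambda>n. n - m) ` {n\<in>A. m < n}. g d)"
    by (subst sum.reindex) (auto simp: inj_on_def sum_distrib_left)
  also have "(\<Sum>d\<in>(\<lambda>n. n - m) ` {n\<in>A. m < n}. g d) \<le> (\<Sum>d\<in>{1..<N}. g d)"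
    using g0 N by (intro sum_mono2) (fastforce intro: le_less_trans[OF diff_le_self])+
  also have "{1..<N} = {1..<m} \<union> {m..<N}" using m mN by auto
  also have "(\<Sum>d\<in>{1..<m} \<union> {m..<N}. g d) = (\<Sum>d\<in>{1..<m}. g d) + (\<Sum>d\<in>{m..<N}. g d)"
    by (intro sum.union_disjoint) auto
  also have "(\<Sum>d\<in>{1..<m}. g d) = 1 / (real m * sqrt (real m)) * (\<Sum>d\<in>{1..<m}. 1 / sqrt (real d))"
    by (simp add: g_def sum_distrib_left)
  also have "\<dots> \<le> 1 / (real m * sqrt (real m)) * (2 * sqrt (real m))"
    by (intro mult_left_mono sum_inverse_sqrt_le) auto
  also have "\<dots> = 2 / real m" using m by simp
  also have "(\<Sum>d\<in>{m..<N}. g d) = 1 / sqrt (real m) * (\<Sum>d\<in>{m..<N}. 1 / (real d * sqrt (real d)))"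
    by (simp add: g_def sum_distrib_left)
  also have "\<dots> \<le> 1 / sqrt (real m) * (4 / sqrt (real m))"
    by (intro mult_left_mono sum_inverse_powr_3_2_le m) auto
  also have "\<dots> = 4 / real m" using m by simp
  finally have "(\<Sum>n\<in>{n\<in>A. m < n}. expectation (\<lambda>\<omega>. Z m \<omega> * Z n \<omega>)) \<le> cov_const * (2 / real m + 4 / real m)"
    using K0 by (simp only: mult_left_mono)
  then show ?thesis by (simp add: mult.commute)
qed

text \<open>Sampling at powers of two makes the harmonic mass of each increment about
  \<open>ln 2\<close>; \<open>T 0\<close> is an empty sum, as the maximal argument requires.\<close>

definition T :: "nat \<Rightarrow> 'a \<Rightarrow> real" where
  "T k \<omega> = (\<Sum>n\<in>{1..<2 ^ k}. Z n \<omega>)"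

lemma T_diff: "i \<le> j \<Longrightarrow> T j \<omega> - T i \<omega> = (\<Sum>n\<in>{2 ^ i..<2 ^ j}. Z n \<omega>)"
  using sum.atLeastLessThan_concat[of 1 "2 ^ i" "2 ^ j" "\<lambda>n. Z n \<omega>"] by (simp add: T_def)

lemma square_sum_Z: "(\<Sum>n\<in>A. Z n \<omega>)\<^sup>2 = (\<Sum>m\<in>A. \<Sum>n\<in>A. Z m \<omega> * Z n \<omega>)"
  by (simp add: power2_eq_square sum_product)

lemma integrable_T_diff_square: "i \<le> j \<Longrightarrow> integrable M (\<lambda>\<omega>. (T j \<omega> - T i \<omega>)\<^sup>2)"
  by (simp add: T_diff square_sum_Z integrable_Z_mult)

text \<open>The diagonal gives \<open>1 / m\<close> and twice the row sum gives
  \<open>12 * cov_const / m\<close>; the harmonic sum over the range is at most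
  \<open>2 * (j - i)\<close>.\<close>

lemma expectation_T_diff_square_le:
  assumes "i \<le> j"
  shows "expectation (\<lambda>\<omega>. (T j \<omega> - T i \<omega>)\<^sup>2) \<le> 2 * (1 + 12 * cov_const) * real (j - i)"
proof -
  define A where "A = {2 ^ i..<(2::nat) ^ j}"
  have A: "finite A" by (simp add: A_def)
  have A1: "n \<ge> 1" if "n \<in> A" for n
    using le_trans[of 1 "2 ^ i" n] that by (simp add: A_def)
  have K0: "cov_const \<ge> 0" using const_nonneg by (simp add: cov_const_def)
  have diag: "expectation (\<lambda>\<omega>. Z m \<omega> * Z m \<omega>) \<le> 1 / real m" if "m \<ge> 1" for m
  proof -
    have "expectation (\<lambda>\<omega>. Z m \<omega> * Z m \<omega>) \<le> expectation (\<lambda>_. 1 / real m)"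
    proof (intro integral_mono integrable_Z_mult)
      fix \<omega>
      have "\<bar>Z m \<omega>\<bar> * \<bar>Z m \<omega>\<bar> \<le> 1 / sqrt (real m) * (1 / sqrt (real m))"
        using Z_abs_le[OF that] by (intro mult_mono) auto
      then show "Z m \<omega> * Z m \<omega> \<le> 1 / real m" using that by simp
    qed simp
    then show ?thesis by (simp add: prob_space)
  qed
  have "expectation (\<lambda>\<omega>. (T j \<omega> - T i \<omega>)\<^sup>2) = (\<Sum>m\<in>A. \<Sum>n\<in>A. expectation (\<lambda>\<omega>. Z m \<omega> * Z n \<omega>))"
    using assms by (simp add: T_diff square_sum_Z integrable_Z_mult A_def)
  also have "\<dots> = (\<Sum>m\<in>A. expectation (\<lambda>\<omega>. Z m \<omega> * Z m \<omega>) + 2 * (\<Sum>n\<in>{n\<in>A. m < n}. expectation (\<lambda>\<omega>. Z m \<omega> * Z n \<omega>)))"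
    by (rule sum_symmetric_square[OF A]) (simp add: mult.commute)
  also have "\<dots> \<le> (\<Sum>m\<in>A. 1 / real m + 2 * (6 * cov_const / real m))"
    using A A1 by (intro sum_mono add_mono mult_left_mono covariance_row_sum_le diag) auto
  also have "\<dots> = (1 + 12 * cov_const) * (\<Sum>m\<in>A. 1 / real m)"
    by (simp add: sum_distrib_left sum.distrib algebra_simps add_divide_distrib)
  also have "(\<Sum>m\<in>A. 1 / real m) \<le> 2 * real (j - i)"
  proof (cases "i = j")
    case True then show ?thesis by (simp add: A_def)
  next
    \<comment> \<open>Now \<open>j - i \<ge> 1\<close>, which absorbs the extra 1 in the harmonic
      bound.\<close>
    case False
    have "(\<Sum>m\<in>A. 1 / real m) \<le> ln (real (2 ^ j) / real (2 ^ i)) + 1 / real (2 ^ i) - 1 / real (2 ^ j)"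
      unfolding A_def using assms by (intro sum_harmonic_bounds(2)) auto
    also have "\<dots> \<le> ln (real (2 ^ j) / real (2 ^ i)) + 1"
    proof -
      have "1 / real (2 ^ i) \<le> 1" "0 \<le> 1 / real (2 ^ j)" by auto
      then show ?thesis by linarith
    qed
    also have "ln (real (2 ^ j) / real (2 ^ i)) = real (j - i) * ln 2"
      using assms by (simp add: ln_div ln_realpow of_nat_diff algebra_simps)
    also have "\<dots> + 1 \<le> real (j - i) * 1 + real (j - i)"
      using False assms ln_2_less_1 by (intro add_mono mult_left_mono) auto
    finally show ?thesis by simp
  qed
  finally have "expectation (\<lambda>\<omega>. (T j \<omega> - T i \<omega>)\<^sup>2) \<le> (1 + 12 * cov_const) * (2 * real (j - i))"
    using K0 by (simp add: mult_left_mono)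
  then show ?thesis by (simp only: mult_ac)
qed

lemma AE_T_small:
  assumes "b > 3/2"
  shows "AE \<omega> in M. (\<lambda>k. T k \<omega> / (sqrt (real k) * ln (real k) powr b)) \<longlonglongrightarrow> 0"
  by (rule quasi_orthogonal_AE_small[OF integrable_T_diff_square expectation_T_diff_square_le _ assms])
     (auto simp: T_def)

lemma AE_T_summable:
  assumes "b > 3/2"
  shows "AE \<omega> in M. summable (\<lambda>i. (T (i + 3) \<omega> - T (i + 2) \<omega>) / (sqrt (real (i + 2)) * ln (real (i + 2)) powr b))"
  by (rule quasi_orthogonal_AE_summable[OF prob_space_axioms _ integrable_T_diff_square expectation_T_diff_square_le _ assms])
     (auto simp: T_def[abs_def])

end

section \<open>Logarithmic averages\<close>

lemma exp_neg_diff_le: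
  fixes x y :: real
  assumes "0 \<le> x" "0 \<le> y"
  shows "\<bar>exp (- x) - exp (- y)\<bar> \<le> \<bar>x - y\<bar>"
proof -
  have *: "exp (- y) - exp (- x) \<le> x - y" if "0 \<le> y" "y \<le> x" for x y :: real
  proof -
    have "exp (- y) - exp (- x) = exp (- y) * (1 - exp (- (x - y)))"
      by (simp add: algebra_simps flip: exp_add)
    also have "\<dots> \<le> 1 * (1 - exp (- (x - y)))"
      using that by (intro mult_right_mono) auto
    also have "\<dots> \<le> x - y"
    proof -
      define z where "z = exp (- (x - y))"
      have "1 + - (x - y) \<le> z" unfolding z_def by (rule exp_ge_add_one_self)
      then show ?thesis unfolding z_def[symmetric] by simp
    qed
    finally show ?thesis .
  qed
  show ?thesis
  proof (cases "y \<le> x")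
    case True
    then have "exp (- x) \<le> exp (- y)" by simp
    then show ?thesis using *[of y x] True assms by simp
  next
    case False
    then have "exp (- y) \<le> exp (- x)" by simp
    then show ?thesis using *[of x y] False assms by simp
  qed
qed

text \<open>The error \<open>(1/2) ^ j\<close> is summable, so each block sum in (ii) may be
  replaced by \<open>ln 2\<close>; the linear lower bound handles the denominator in (i).\<close>

lemma sum_dyadic_harmonic_bounds:
  shows "\<bar>(\<Sum>n\<in>{2 ^ j..<2 ^ (j + 1) :: nat}. 1 / real n) - ln 2\<bar> \<le> (1 / 2) ^ j" (is ?A)
    and "real j / 2 \<le> (\<Sum>n\<in>{1..<2 ^ j :: nat}. 1 / real n)" (is ?B)
proof -
  have "ln (real (2 ^ (j + 1)) / real (2 ^ j)) = ln 2" by simp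
  moreover have "1 / real (2 ^ j) = (1 / 2) ^ j" by (simp add: power_divide)
  moreover have "0 \<le> 1 / real (2 ^ (j + 1))" by simp
  moreover have "ln (real (2 ^ (j + 1)) / real (2 ^ j)) \<le> (\<Sum>n\<in>{2 ^ j..<2 ^ (j + 1)}. 1 / real n)"
    by (rule sum_harmonic_bounds(1)) auto
  moreover have "(\<Sum>n\<in>{2 ^ j..<2 ^ (j + 1)}. 1 / real n) \<le>
      ln (real (2 ^ (j + 1)) / real (2 ^ j)) + 1 / real (2 ^ j) - 1 / real (2 ^ (j + 1))"
    by (rule sum_harmonic_bounds(2)) auto
  moreover have "0 \<le> (1 / 2 :: real) ^ j" by simp
  ultimately show ?A unfolding abs_le_iff by linarith
  have "real j * (1 / 2) \<le> real j * ln 2" using ln2_ge_two_thirds by (intro mult_left_mono) auto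
  also have "\<dots> = ln (real (2 ^ j) / real 1)" by (simp add: ln_realpow)
  also have "\<dots> \<le> (\<Sum>n\<in>{1..<2 ^ j}. 1 / real n)" by (rule sum_harmonic_bounds(1)) auto
  finally show ?B by simp
qed

text \<open>Deterministic, applied path by path: \<open>h\<close> is the weighted indicator and
  \<open>q\<close> its mean. In the splitting \<open>A / n + (q n - A / n) + (h n - q n)\<close> the
  bias in the middle yields \<open>E\<close> and the fluctuation at the end yields
  \<open>F\<close>.\<close>

lemma logarithmic_average_expansion:
  fixes h q d :: "nat \<Rightarrow> real" and A C b :: real
  assumes lim: "(\<lambda>k. (\<Sum>n\<in>{1..<2 ^ k :: nat}. h n - q n) / (sqrt (real k) * ln (real k) powr b)) \<longlonglongrightarrow> 0"
    and q: "\<And>n. n \<ge> 1 \<Longrightarrow> \<bar>q n - A / real n\<bar> \<le> C * (d n / real n)"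
    and C: "0 \<le> C" and d: "\<And>n. 0 \<le> d n" and b: "b > 0"
  shows "\<exists>E F. E \<in> O(\<lambda>N. 1 / real N * (\<Sum>n\<in>{1..<2 ^ (N + 1)}. d n / real n)) \<and>
    F \<in> o(\<lambda>N. ln (real N) powr b / sqrt (real N)) \<and>
    (\<forall>\<^sub>F N in sequentially. (\<Sum>n\<in>{1..<2 ^ (N + 1)}. h n) / (\<Sum>n\<in>{1..<2 ^ (N + 1) :: nat}. 1 / real n) = A + E N + F N)"
proof (intro exI conjI)
  define H where "H N = (\<Sum>n\<in>{1..<2 ^ (N + 1) :: nat}. 1 / real n)" for N
  define R where "R N = (\<Sum>n\<in>{1..<2 ^ (N + 1) :: nat}. d n / real n)" for N
  define t where "t k = (\<Sum>n\<in>{1..<2 ^ k :: nat}. h n - q n)" for k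
  define E where "E N = (\<Sum>n\<in>{1..<2 ^ (N + 1) :: nat}. q n - A / real n) / H N" for N
  define F where "F N = t (N + 1) / H N" for N
  have H: "real (N + 1) / 2 \<le> H N" for N
    unfolding H_def by (rule sum_dyadic_harmonic_bounds(2))
  have Hpos: "0 < H N" for N
    by (rule less_le_trans[OF _ H]) simp
  have R: "0 \<le> R N" for N unfolding R_def using d by (intro sum_nonneg) auto
  show "E \<in> O(\<lambda>N. 1 / real N * (\<Sum>n\<in>{1..<2 ^ (N + 1)}. d n / real n))"
    unfolding R_def[symmetric]
  proof (rule bigoI)
    show "\<forall>\<^sub>F N in sequentially. norm (E N) \<le> (2 * C) * norm (1 / real N * R N)"
      using eventually_ge_at_top[of 1]
    proof eventually_elim
      case (elim N)
      have le: "\<bar>\<Sum>n\<in>{1..<2 ^ (N + 1) :: nat}. q n - A / real n\<bar> \<le> C * R N"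
        unfolding R_def sum_distrib_left by (intro order_trans[OF sum_abs] sum_mono q) auto
      have "norm (E N) \<le> (C * R N) / (real N / 2)"
        unfolding E_def real_norm_def abs_divide abs_of_pos[OF Hpos]
        using le C R[of N] H[of N] elim by (intro frac_le) auto
      also have "\<dots> = (2 * C) * norm (1 / real N * R N)" using R[of N] by simp
      finally show ?case .
    qed
  qed
  show "F \<in> o(\<lambda>N. ln (real N) powr b / sqrt (real N))"
  proof (rule smalloI_tendsto)
    show "\<forall>\<^sub>F N in sequentially. ln (real N) powr b / sqrt (real N) \<noteq> 0"
      using eventually_ge_at_top[of 2] by eventually_elim auto
    have "(\<lambda>N. t (N + 1) / (sqrt (real (N + 1)) * ln (real (N + 1)) powr b)) \<longlonglongrightarrow> 0"
      using lim unfolding t_def[symmetric] by (rule LIMSEQ_ignore_initial_segment)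
    then show "(\<lambda>N. F N / (ln (real N) powr b / sqrt (real N))) \<longlonglongrightarrow> 0"
    \<comment> \<open>The sum is \<open>t (N + 1)\<close> but the rate is taken at \<open>N\<close>:
      \<open>2 powr b\<close> pays for replacing \<open>ln (N + 1)\<close> by \<open>ln N\<close>,
      and the other 2 comes from \<open>H N \<ge> (N + 1) / 2\<close>.\<close>
    proof (rule tendsto_0_le[where K = "2 * 2 powr b"])
      show "\<forall>\<^sub>F N in sequentially. norm (F N / (ln (real N) powr b / sqrt (real N))) \<le>
          norm (t (N + 1) / (sqrt (real (N + 1)) * ln (real (N + 1)) powr b)) * (2 * 2 powr b)"
        using eventually_ge_at_top[of 2]
      proof eventually_elim
        case (elim N)
        define L L' where "L = ln (real N) powr b" and "L' = ln (real (N + 1)) powr b"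
        have L: "L > 0" "L' > 0" using elim by (auto simp: L_def L'_def)
        \<comment> \<open>Valid from \<open>N = 2\<close> on; it gives
          \<open>ln (N + 1) \<le> 2 * ln N\<close>.\<close>
        have "N + 1 \<le> N * N" using mult_le_mono1[OF elim, of N] elim by linarith
        then have "real (N + 1) \<le> real N * real N" by (metis of_nat_le_iff of_nat_mult)
        then have "ln (real (N + 1)) \<le> ln (real N * real N)" by (intro ln_mono) auto
        also have "\<dots> = 2 * ln (real N)" using elim by (simp add: ln_mult)
        finally have "L' \<le> (2 * ln (real N)) powr b"
          unfolding L'_def using b by (intro powr_mono2) auto
        also have "\<dots> = 2 powr b * L" by (simp add: L_def powr_mult)
        finally have LL: "L' \<le> 2 powr b * L" .
        have sq: "sqrt (real N) * sqrt (real (N + 1)) \<le> real (N + 1)"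
        proof -
          have "sqrt (real N) * sqrt (real (N + 1)) \<le> sqrt (real (N + 1)) * sqrt (real (N + 1))"
            by (intro mult_right_mono) auto
          then show ?thesis by simp
        qed
        have "sqrt (real N) * sqrt (real (N + 1)) * L' \<le> (2 * H N) * (2 powr b * L)"
        proof (rule mult_mono[OF _ LL])
          show "sqrt (real N) * sqrt (real (N + 1)) \<le> 2 * H N"
            using H[of N] by (intro order_trans[OF sq]) simp
          show "0 \<le> 2 * H N" using Hpos[of N] by simp
        qed (use L in simp)
        then have "sqrt (real N) / (H N * L) \<le> (2 * 2 powr b) / (sqrt (real (N + 1)) * L')"
          using L Hpos[of N] by (simp add: frac_le_eq divide_le_eq le_divide_eq mult_ac)
        then have "\<bar>t (N + 1)\<bar> * (sqrt (real N) / (H N * L)) \<le> \<bar>t (N + 1)\<bar> * ((2 * 2 powr b) / (sqrt (real (N + 1)) * L'))"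
          by (intro mult_left_mono) auto
        then show ?case
          unfolding L_def[symmetric] L'_def[symmetric] F_def
          using L Hpos[of N] by (simp add: abs_mult)
      qed
    qed
  qed
  have "(\<Sum>n\<in>{1..<2 ^ (N + 1)}. h n) / H N = A + E N + F N" for N
  proof -
    have "(\<Sum>n\<in>{1..<2 ^ (N + 1)}. h n) =
        (\<Sum>n\<in>{1..<2 ^ (N + 1)}. A * (1 / real n) + (q n - A / real n) + (h n - q n))"
      by (intro sum.cong) auto
    also have "\<dots> = A * H N + (\<Sum>n\<in>{1..<2 ^ (N + 1) :: nat}. q n - A / real n) + t (N + 1)"
      by (simp only: sum.distrib H_def t_def sum_distrib_left)
    finally show ?thesis using Hpos[of N] by (simp add: E_def F_def add_divide_distrib)
  qed
  then show "\<forall>\<^sub>F N in sequentially. (\<Sum>n\<in>{1..<2 ^ (N + 1)}. h n) / (\<Sum>n\<in>{1..<2 ^ (N + 1) :: nat}. 1 / real n) = A + E N + F N"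
    by (simp add: H_def)
qed

lemma dyadic_weight_bounds:
  fixes b :: real
  assumes "b > 0"
  shows "0 \<le> 1 / (sqrt (real (i + 2)) * ln (real (i + 2)) powr b)"
    and "1 / (sqrt (real (i + 2)) * ln (real (i + 2)) powr b) \<le> 1 / ln 2 powr b"
proof -
  have "1 * ln 2 powr b \<le> sqrt (real (i + 2)) * ln (real (i + 2)) powr b"
    using assms by (intro mult_mono powr_mono2) auto
  then show "1 / (sqrt (real (i + 2)) * ln (real (i + 2)) powr b) \<le> 1 / ln 2 powr b"
    by (intro divide_left_mono) (auto intro!: mult_pos_pos)
qed simp

text \<open>The same splitting, block by block: the fluctuations converge by \<open>st\<close>, the
  bias is dominated by \<open>sd\<close>, and the harmonic block sum deviates from
  \<open>ln 2\<close> geometrically little while the weights stay below \<open>L\<close>.\<close>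

lemma summable_weighted_dyadic_blocks:
  fixes h q d w :: "nat \<Rightarrow> real" and A C L :: real
  assumes w: "\<And>i. 0 \<le> w i" "\<And>i. w i \<le> L"
    and sd: "summable (\<lambda>i. w i * (\<Sum>n\<in>{2 ^ (i + 2)..<2 ^ (i + 2 + 1) :: nat}. d n / real n))"
    and st: "summable (\<lambda>i. w i * (\<Sum>n\<in>{2 ^ (i + 2)..<2 ^ (i + 2 + 1) :: nat}. h n - q n))"
    and q: "\<And>n. n \<ge> 1 \<Longrightarrow> \<bar>q n - A / real n\<bar> \<le> C * (d n / real n)"
  shows "summable (\<lambda>i. w i * ((\<Sum>n\<in>{2 ^ (i + 2)..<2 ^ (i + 2 + 1) :: nat}. h n) - A * ln 2))"
proof -
  define J where "J i = {2 ^ (i + 2)..<2 ^ (i + 2 + 1) :: nat}" for i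
  have J: "n \<ge> 1" if "n \<in> J i" for n i
    using le_trans[of 1 "2 ^ (i + 2)" n] that by (simp add: J_def)
  have s2: "summable (\<lambda>i. w i * (\<Sum>n\<in>J i. q n - A / real n))"
  proof (rule summable_comparison_test)
    show "summable (\<lambda>i. C * (w i * (\<Sum>n\<in>J i. d n / real n)))"
      using sd unfolding J_def by (rule summable_mult)
    have "norm (w i * (\<Sum>n\<in>J i. q n - A / real n)) \<le> C * (w i * (\<Sum>n\<in>J i. d n / real n))" for i
    proof -
      have "norm (w i * (\<Sum>n\<in>J i. q n - A / real n)) = w i * \<bar>\<Sum>n\<in>J i. q n - A / real n\<bar>"
        using w(1) by (simp add: abs_mult)
      also have "\<dots> \<le> w i * (\<Sum>n\<in>J i. C * (d n / real n))"
        by (intro mult_left_mono order_trans[OF sum_abs] sum_mono q w(1) J)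
      finally show ?thesis by (simp add: sum_distrib_left mult_ac)
    qed
    then show "\<exists>N. \<forall>i\<ge>N. norm (w i * (\<Sum>n\<in>J i. q n - A / real n)) \<le> C * (w i * (\<Sum>n\<in>J i. d n / real n))"
      by blast
  qed
  have s3: "summable (\<lambda>i. w i * (A * ((\<Sum>n\<in>J i. 1 / real n) - ln 2)))"
  proof (rule summable_comparison_test)
    show "summable (\<lambda>i. L * \<bar>A\<bar> * (1 / 2) ^ (i + 2))"
      by (intro summable_mult summable_ignore_initial_segment summable_geometric) simp
    have "norm (w i * (A * ((\<Sum>n\<in>J i. 1 / real n) - ln 2))) \<le> L * \<bar>A\<bar> * (1 / 2) ^ (i + 2)" for i
    proof -
      have "norm (w i * (A * ((\<Sum>n\<in>J i. 1 / real n) - ln 2))) = w i * \<bar>A\<bar> * \<bar>(\<Sum>n\<in>J i. 1 / real n) - ln 2\<bar>"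
        using w(1) by (simp add: abs_mult)
      also have "\<dots> \<le> L * \<bar>A\<bar> * (1 / 2) ^ (i + 2)"
        using order_trans[OF w] unfolding J_def
        by (intro mult_mono sum_dyadic_harmonic_bounds(1) w(2)) auto
      finally show ?thesis .
    qed
    then show "\<exists>N. \<forall>i\<ge>N. norm (w i * (A * ((\<Sum>n\<in>J i. 1 / real n) - ln 2))) \<le> L * \<bar>A\<bar> * (1 / 2) ^ (i + 2)"
      by blast
  qed
  have "(\<Sum>n\<in>J i. h n) = (\<Sum>n\<in>J i. (h n - q n) + (q n - A / real n) + A * (1 / real n))" for i
    by (intro sum.cong) auto
  then have "(\<Sum>n\<in>J i. h n) = (\<Sum>n\<in>J i. h n - q n) + (\<Sum>n\<in>J i. q n - A / real n) + A * (\<Sum>n\<in>J i. 1 / real n)" for i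
    by (simp only: sum.distrib sum_distrib_left)
  then have "w i * ((\<Sum>n\<in>J i. h n) - A * ln 2) = w i * (\<Sum>n\<in>J i. h n - q n) +
      w i * (\<Sum>n\<in>J i. q n - A / real n) + w i * (A * ((\<Sum>n\<in>J i. 1 / real n) - ln 2))" for i
    by (simp only: right_diff_distrib distrib_left)
  then show ?thesis
    using summable_add[OF summable_add[OF st[folded J_def] s2] s3] by (simp add: J_def)
qed

text \<open>On block \<open>j\<close> the error is \<open>O(j powr (- 1/2))\<close> because
  \<open>ln n \<ge> j * ln 2\<close>; with the weight this becomes
  \<open>1 / (j * ln j powr b)\<close>.\<close>

lemma summable_weighted_dyadic_errors:
  fixes d :: "nat \<Rightarrow> real" and b :: real
  assumes d: "d \<in> O(\<lambda>n. ln (real n) powr (- 1/2))" and b: "b > 1"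
  shows "summable (\<lambda>i. 1 / (sqrt (real (i + 2)) * ln (real (i + 2)) powr b) *
    (\<Sum>n\<in>{2 ^ (i + 2)..<2 ^ (i + 2 + 1) :: nat}. d n / real n))"
proof -
  obtain c where c: "c > 0" "\<forall>\<^sub>F n in sequentially. norm (d n) \<le> c * norm (ln (real n) powr (- 1/2))"
    using d by (elim landau_o.bigE)
  then obtain n0 where n0: "\<And>n. n \<ge> n0 \<Longrightarrow> \<bar>d n\<bar> \<le> c * ln (real n) powr (- 1/2)"
    by (auto simp: eventually_sequentially)
  \<comment> \<open>The 2 bounds the harmonic sum over one block, and \<open>ln 2\<close> comes from
    \<open>ln n \<ge> j * ln 2\<close>.\<close>
  define K where "K = 2 * c * ln 2 powr (- 1/2)"
  show ?thesis
  proof (rule summable_comparison_test)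
    show "summable (\<lambda>i. K * (1 / (real (i + 2) * ln (real (i + 2)) powr b)))"
      by (intro summable_mult summable_inverse_ln_powr b)
    show "\<exists>N. \<forall>i\<ge>N. norm (1 / (sqrt (real (i + 2)) * ln (real (i + 2)) powr b) *
        (\<Sum>n\<in>{2 ^ (i + 2)..<2 ^ (i + 2 + 1) :: nat}. d n / real n)) \<le> K * (1 / (real (i + 2) * ln (real (i + 2)) powr b))"
    proof (intro exI[of _ n0] allI impI)
      fix i assume i: "n0 \<le> i"
      define j where "j = i + 2"
      have jn: "n0 \<le> n \<and> real j * ln 2 \<le> ln (real n) \<and> 1 \<le> n" if "n \<in> {2 ^ j..<2 ^ (j + 1)}" for n
      proof -
        \<comment> \<open>This makes \<open>n0\<close> a sufficient threshold for the block index: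
          \<open>n \<ge> 2 ^ j > j \<ge> n0\<close>.\<close>
        have "j < 2 ^ j" by (rule less_exp)
        then have "n0 \<le> n" "1 \<le> n" using that i by (auto simp: j_def)
        have "(2::real) ^ j \<le> real n" using that by (metis atLeastLessThan_iff of_nat_le_iff of_nat_numeral of_nat_power)
        then have "ln ((2::real) ^ j) \<le> ln (real n)" by (intro ln_mono) auto
        then show ?thesis using \<open>n0 \<le> n\<close> \<open>1 \<le> n\<close> by (simp add: ln_realpow)
      qed
      have "\<bar>\<Sum>n\<in>{2 ^ j..<2 ^ (j + 1) :: nat}. d n / real n\<bar> \<le> (\<Sum>n\<in>{2 ^ j..<2 ^ (j + 1) :: nat}. (c * (real j * ln 2) powr (- 1/2)) * (1 / real n))"
      proof (intro order_trans[OF sum_abs] sum_mono)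
        fix n :: nat assume n: "n \<in> {2 ^ j..<2 ^ (j + 1)}"
        have "\<bar>d n\<bar> \<le> c * ln (real n) powr (- 1/2)" using jn[OF n] by (intro n0) auto
        also have "\<dots> \<le> c * (real j * ln 2) powr (- 1/2)"
          using jn[OF n] c(1) by (intro mult_left_mono powr_mono2') (auto simp: j_def)
        finally have "\<bar>d n\<bar> / real n \<le> (c * (real j * ln 2) powr (- 1/2)) / real n"
          by (intro divide_right_mono) auto
        then show "\<bar>d n / real n\<bar> \<le> (c * (real j * ln 2) powr (- 1/2)) * (1 / real n)" by (simp add: abs_divide)
      qed
      also have "\<dots> = (c * (real j * ln 2) powr (- 1/2)) * (\<Sum>n\<in>{2 ^ j..<2 ^ (j + 1) :: nat}. 1 / real n)"
        by (rule sum_distrib_left[symmetric])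
      also have "\<dots> \<le> (c * (real j * ln 2) powr (- 1/2)) * 2"
      proof (intro mult_left_mono)
        have "(1 / 2 :: real) ^ j \<le> 1" by (intro power_le_one) auto
        then show "(\<Sum>n\<in>{2 ^ j..<2 ^ (j + 1) :: nat}. 1 / real n) \<le> 2"
          using sum_dyadic_harmonic_bounds(1)[of j] ln_2_less_1 by linarith
      qed (use c in auto)
      also have "\<dots> = K / sqrt (real j)"
        by (simp add: K_def powr_mult powr_minus powr_half_sqrt field_simps)
      finally have le: "\<bar>\<Sum>n\<in>{2 ^ j..<2 ^ (j + 1) :: nat}. d n / real n\<bar> \<le> K / sqrt (real j)" .
      have "norm (1 / (sqrt (real j) * ln (real j) powr b) * (\<Sum>n\<in>{2 ^ j..<2 ^ (j + 1) :: nat}. d n / real n)) =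
          1 / (sqrt (real j) * ln (real j) powr b) * \<bar>\<Sum>n\<in>{2 ^ j..<2 ^ (j + 1) :: nat}. d n / real n\<bar>"
        by (simp add: abs_mult)
      also have "\<dots> \<le> 1 / (sqrt (real j) * ln (real j) powr b) * (K / sqrt (real j))"
        by (intro mult_left_mono le) auto
      also have "\<dots> = K * (1 / (real j * ln (real j) powr b))" by simp
      finally show "norm (1 / (sqrt (real (i + 2)) * ln (real (i + 2)) powr b) *
        (\<Sum>n\<in>{2 ^ (i + 2)..<2 ^ (i + 2 + 1) :: nat}. d n / real n)) \<le> K * (1 / (real (i + 2) * ln (real (i + 2)) powr b))"
        unfolding j_def .
    qed
  qed
qed

text \<open>A positive sum needs a positive term, and that minimum itself serves as
  \<open>p\<close>.\<close>

lemma exists_adjacent_atoms: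
  assumes "lattice_overlap P X v D > 0"
  shows "\<exists>a p. p > 0 \<and> p \<le> \<P>(\<omega> in P. X \<omega> = a) \<and> p \<le> \<P>(\<omega> in P. X \<omega> = a + D)"
proof -
  define f where "f k = min (\<P>(\<omega> in P. X \<omega> = v + D * of_int k)) (\<P>(\<omega> in P. X \<omega> = v + D * of_int (k + 1)))" for k :: int
  have "\<exists>k. f k > 0"
  proof (rule ccontr)
    assume "\<not> (\<exists>k. f k > 0)"
    moreover have "0 \<le> f k" for k by (simp add: f_def)
    ultimately have "f k = 0" for k by (meson not_less order.antisym)
    then have "lattice_overlap P X v D = 0"
      unfolding lattice_overlap_def f_def by (intro infsum_0) simp
    then show False using assms by simp
  qed
  then obtain k where "f k > 0" ..
  moreover have "v + D * of_int (k + 1) = v + D * of_int k + D" by (simp add: algebra_simps)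
  ultimately have "f k > 0 \<and> f k \<le> \<P>(\<omega> in P. X \<omega> = v + D * of_int k) \<and>
      f k \<le> \<P>(\<omega> in P. X \<omega> = v + D * of_int k + D)"
    by (auto simp: f_def add.assoc)
  then show ?thesis by blast
qed

text \<open>The index \<open>i + 2\<close> encodes \<open>j \<ge> 2\<close>, and the criterion in
  parentheses in (ii) is the last conjunct. The two Landau terms of (i) are sequences
  \<open>E\<close> and \<open>F\<close> chosen for each \<open>\<omega>\<close>.\<close>

theorem theorem6p1:
  fixes P :: "'b measure" and X :: "'b \<Rightarrow> real"
    and M :: "'a measure" and Xs :: "nat \<Rightarrow> 'a \<Rightarrow> real" and S :: "nat \<Rightarrow> 'a \<Rightarrow> real"
    and v\<^sub>0 D \<mu> \<sigma> \<kappa> b :: real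
    and kap \<epsilon> \<delta> :: "nat \<Rightarrow> real"
  assumes "prob_space P" and "X \<in> borel_measurable P"
    and "integrable P (\<lambda>\<omega>. (X \<omega>)\<^sup>2)"
    and "D > 0"
    and "\<P>(\<omega> in P. X \<omega> \<in> lattice_set v\<^sub>0 D) = 1"
    and "maximal_span P X D"
    and "\<mu> = prob_space.expectation P X"
    and "\<sigma>\<^sup>2 = prob_space.variance P X" and "\<sigma> > 0"
    and "lattice_overlap P X v\<^sub>0 D > 0"
    and "prob_space M"
    and "prob_space.indep_vars M (\<lambda>_. borel) Xs {1..}"
    and "\<forall>i\<ge>1. distr M borel (Xs i) = distr P borel X"
    and S_def: "\<forall>n \<omega>. S n \<omega> = (\<Sum>i=1..n. Xs i \<omega>)"
    and "\<forall>n\<ge>1. kap n \<in> lattice_set (real n * v\<^sub>0) D"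
    and "\<forall>n\<ge>1. kap n = real n * \<mu> + \<kappa> * sqrt (real n) * (1 + \<epsilon> n)"
    and "\<epsilon> \<longlonglongrightarrow> 0"
    and \<delta>_def: "\<forall>n. \<delta> n =
      \<bar>\<sigma> * sqrt (real n) * \<P>(\<omega> in M. S n \<omega> = kap n)
        - D / sqrt (2 * pi) * exp (- ((kap n - real n * \<mu>)\<^sup>2 / (2 * real n * \<sigma>\<^sup>2)))\<bar>"
    and "b > 3/2"
  shows
    "(AE \<omega> in M. \<exists>E F.
        E \<in> O(\<lambda>N. 1 / real N * (\<Sum>n\<in>{1..<2 ^ (N + 1)}. (\<delta> n + \<bar>\<epsilon> n\<bar>) / real n)) \<and>
        F \<in> o(\<lambda>N. ln (real N) powr b / sqrt (real N)) \<and>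
        (\<forall>\<^sub>F N in sequentially.
          (\<Sum>n\<in>{1..<2 ^ (N + 1)}. 1 / sqrt (real n) * of_bool (S n \<omega> = kap n))
            / (\<Sum>n\<in>{1..<2 ^ (N + 1) :: nat}. 1 / real n)
          = D / (\<sigma> * sqrt (2 * pi)) * exp (- (\<kappa>\<^sup>2 / (2 * \<sigma>\<^sup>2))) + E N + F N)) \<and>
     (summable (\<lambda>i. let j = i + 2 in
        1 / (sqrt (real j) * ln (real j) powr b)
          * (\<Sum>n\<in>{2 ^ j..<2 ^ (j + 1)}. (\<delta> n + \<bar>\<epsilon> n\<bar>) / real n))
      \<longrightarrow> (AE \<omega> in M. summable (\<lambda>i. let j = i + 2 in
        1 / (sqrt (real j) * ln (real j) powr b)
          * ((\<Sum>n\<in>{2 ^ j..<2 ^ (j + 1)}. 1 / sqrt (real n) * of_bool (S n \<omega> = kap n))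
             - D * ln 2 / (\<sigma> * sqrt (2 * pi)) * exp (- (\<kappa>\<^sup>2 / (2 * \<sigma>\<^sup>2))))))) \<and>
     ((\<lambda>n. max (\<delta> n) \<bar>\<epsilon> n\<bar>) \<in> O(\<lambda>n. ln (real n) powr (- 1/2))
      \<longrightarrow> summable (\<lambda>i. let j = i + 2 in
        1 / (sqrt (real j) * ln (real j) powr b)
          * (\<Sum>n\<in>{2 ^ j..<2 ^ (j + 1)}. (\<delta> n + \<bar>\<epsilon> n\<bar>) / real n)))"
proof -
  interpret P: prob_space P by fact
  interpret M: prob_space M by fact
  have X [measurable]: "X \<in> borel_measurable P" by fact
  have \<sigma>: "\<sigma> > 0" and D: "D > 0" and b: "b > 3/2" by fact+
  have kap: "kap n = real n * \<mu> + \<kappa> * sqrt (real n) * (1 + \<epsilon> n)" if "n \<ge> 1" for n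
    using assms(16) that by blast
  define \<nu> where "\<nu> = distr P borel X"
  obtain a p where p: "p > 0" "p \<le> \<P>(\<omega> in P. X \<omega> = a)" "p \<le> \<P>(\<omega> in P. X \<omega> = a + D)"
    using exists_adjacent_atoms[OF assms(10)] by blast
  have atom: "measure \<nu> {x} = \<P>(\<omega> in P. X \<omega> = x)" for x
    unfolding \<nu>_def by (subst measure_distr) (auto intro!: arg_cong[where f = P.prob])
  have \<nu>: "real_distribution \<nu>" unfolding \<nu>_def by (rule P.real_distribution_distr) simp
  \<comment> \<open>A convergent sequence is bounded; this puts the targets within
    \<open>|\<kappa>| * (1 + B) * sqrt n\<close> of the drift.\<close>
  obtain B where "B > 0" "\<forall>n. norm (\<epsilon> n) \<le> B"
    using convergent_imp_Bseq[OF convergentI[OF assms(17)]] by (rule BseqE)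
  then have B: "\<bar>\<epsilon> n\<bar> \<le> B" "B > 0" for n by auto
  have [measurable]: "lattice_set v\<^sub>0 D \<in> sets borel"
    unfolding lattice_set_def by (rule sets.countable) auto
  interpret lattice_walk_points M Xs \<nu> v\<^sub>0 D \<mu> "\<sigma>\<^sup>2" "p * D\<^sup>2 / 6" kap "\<bar>\<kappa>\<bar> * (1 + B)"
  proof (intro lattice_walk_points.intro lattice_walk.intro lattice_walk_axioms.intro lattice_walk_points_axioms.intro)
    show "prob_space M" by fact
    show "real_distribution \<nu>" by (rule \<nu>)
    show "M.indep_vars (\<lambda>_. borel) Xs {1..}" by fact
    show "distr M borel (Xs i) = \<nu>" if "i \<ge> 1" for i using assms(13) that by (simp add: \<nu>_def)
    show "D > 0" by fact
    have "AE \<omega> in P. X \<omega> \<in> lattice_set v\<^sub>0 D"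
      using assms(5) by (subst (asm) P.prob_Collect_eq_1) auto
    then show "AE x in \<nu>. x \<in> lattice_set v\<^sub>0 D"
      unfolding \<nu>_def by (subst AE_distr_iff) auto
    show "integrable \<nu> (\<lambda>x. x\<^sup>2)"
      unfolding \<nu>_def using assms(3) by (subst integrable_distr_eq) auto
    show "(\<integral>x. x \<partial>\<nu>) = \<mu>" unfolding \<nu>_def assms(7) by (subst integral_distr) auto
    show "(\<integral>x. (x - \<mu>)\<^sup>2 \<partial>\<nu>) = \<sigma>\<^sup>2"
      unfolding \<nu>_def assms(8) by (subst integral_distr) (auto simp: assms(7))
    show "0 < p * D\<^sup>2 / 6" using p D by simp
    show "norm (char \<nu> t) \<le> exp (- (p * D\<^sup>2 / 6 * t\<^sup>2))" if "\<bar>t\<bar> \<le> pi / D" for t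
      by (rule char_bound_adjacent_atoms[OF \<nu> D p(1) _ _ that]) (use p in \<open>auto simp: atom\<close>)
    show "kap n \<in> lattice_set (real n * v\<^sub>0) D" if "n \<ge> 1" for n using assms(15) that by blast
    show "\<bar>kap n - real n * \<mu>\<bar> \<le> \<bar>\<kappa>\<bar> * (1 + B) * sqrt (real n)" if "n \<ge> 1" for n
    proof -
      have "\<bar>1 + \<epsilon> n\<bar> \<le> 1 + B" using B(1)[of n] by linarith
      then have "\<bar>\<kappa>\<bar> * sqrt (real n) * \<bar>1 + \<epsilon> n\<bar> \<le> \<bar>\<kappa>\<bar> * sqrt (real n) * (1 + B)"
        by (intro mult_left_mono) auto
      then show ?thesis by (simp add: kap[OF that] abs_mult mult_ac)
    qed
  qed
  define A where "A = D / (\<sigma> * sqrt (2 * pi)) * exp (- (\<kappa>\<^sup>2 / (2 * \<sigma>\<^sup>2)))"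
  define d where "d n = \<delta> n + \<bar>\<epsilon> n\<bar>" for n
  define q where "q n = hit_prob n / sqrt (real n)" for n
  define h where "h \<omega> n = 1 / sqrt (real n) * of_bool (S n \<omega> = kap n)" for \<omega> n
  define e where "e = \<kappa>\<^sup>2 / (2 * \<sigma>\<^sup>2)"
  define G where "G = D / sqrt (2 * pi)"
  \<comment> \<open>1 pays for \<open>\<delta> n\<close>, \<open>G * e * (2 + B)\<close> for the
    change of exponent caused by \<open>\<epsilon> n\<close>, and dividing by
    \<open>\<sigma>\<close> undoes the normalisation inside \<open>\<delta> n\<close>.\<close>
  define C where "C = (1 + G * e * (2 + B)) / \<sigma>"
  have \<delta>0: "0 \<le> \<delta> n" for n using \<delta>_def by simp
  have d0: "0 \<le> d n" for n using \<delta>0[of n] by (simp add: d_def)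
  have e0: "0 \<le> e" and G0: "0 \<le> G" using D by (auto simp: e_def G_def)
  have C0: "0 \<le> C" using e0 G0 B(2) \<sigma> by (simp add: C_def)
  have hZ: "h \<omega> n - q n = Z n \<omega>" for \<omega> n
    by (simp add: h_def q_def Z_def hit_def S_def diff_divide_distrib)
  have q: "\<bar>q n - A / real n\<bar> \<le> C * (d n / real n)" if n: "n \<ge> 1" for n
  proof -
    \<comment> \<open>In this form the exponent differs from its limit \<open>e\<close> by
      \<open>e * \<epsilon> n * (2 + \<epsilon> n)\<close>, which is linear in
      \<open>|\<epsilon> n|\<close> thanks to the bound \<open>B\<close>.\<close>
    have "(kap n - real n * \<mu>)\<^sup>2 / (2 * real n * \<sigma>\<^sup>2) = e * (1 + \<epsilon> n)\<^sup>2"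
    proof -
      have "(kap n - real n * \<mu>)\<^sup>2 = real n * (\<kappa>\<^sup>2 * (1 + \<epsilon> n)\<^sup>2)"
        by (simp add: kap[OF n] power_mult_distrib)
      then show ?thesis using n \<sigma> by (simp add: e_def)
    qed
    then have \<delta>: "\<delta> n = \<bar>\<sigma> * sqrt (real n) * hit_prob n - G * exp (- (e * (1 + \<epsilon> n)\<^sup>2))\<bar>"
      using \<delta>_def by (simp add: hit_prob_def S_def G_def)
    have "\<bar>exp (- (e * (1 + \<epsilon> n)\<^sup>2)) - exp (- e)\<bar> \<le> \<bar>e * (1 + \<epsilon> n)\<^sup>2 - e\<bar>"
      using e0 by (intro exp_neg_diff_le) auto
    also have "e * (1 + \<epsilon> n)\<^sup>2 - e = e * (\<epsilon> n * (2 + \<epsilon> n))"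
      by (simp add: power2_eq_square algebra_simps)
    also have "\<bar>\<dots>\<bar> = e * (\<bar>\<epsilon> n\<bar> * \<bar>2 + \<epsilon> n\<bar>)" using e0 by (simp add: abs_mult)
    also have "\<dots> \<le> e * (\<bar>\<epsilon> n\<bar> * (2 + B))"
      using e0 B(1)[of n] by (intro mult_left_mono) auto
    finally have "G * \<bar>exp (- (e * (1 + \<epsilon> n)\<^sup>2)) - exp (- e)\<bar> \<le> G * (e * (\<bar>\<epsilon> n\<bar> * (2 + B)))"
      using G0 by (rule mult_left_mono)
    then have "\<bar>G * exp (- (e * (1 + \<epsilon> n)\<^sup>2)) - G * exp (- e)\<bar> \<le> G * e * (2 + B) * \<bar>\<epsilon> n\<bar>"
      using G0 by (simp add: abs_mult mult_ac flip: right_diff_distrib)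
    then have "\<bar>\<sigma> * sqrt (real n) * hit_prob n - G * exp (- e)\<bar> \<le> \<delta> n + G * e * (2 + B) * \<bar>\<epsilon> n\<bar>"
      unfolding \<delta> by linarith
    also have "\<dots> \<le> (1 + G * e * (2 + B)) * d n"
    proof -
      have "0 \<le> G * e * (2 + B) * \<delta> n" using G0 e0 B(2) \<delta>0 by simp
      then show ?thesis using \<delta>0[of n] by (simp add: d_def algebra_simps)
    qed
    finally have "\<bar>\<sigma> * sqrt (real n) * hit_prob n - G * exp (- e)\<bar> / (\<sigma> * real n) \<le> (1 + G * e * (2 + B)) * d n / (\<sigma> * real n)"
      using \<sigma> by (intro divide_right_mono) auto
    moreover have "q n - A / real n = (\<sigma> * sqrt (real n) * hit_prob n - G * exp (- e)) / (\<sigma> * real n)"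
    proof -
      have "hit_prob n / sqrt (real n) = sqrt (real n) * hit_prob n / real n"
        using n by (simp add: field_simps)
      then show ?thesis using \<sigma> n by (simp add: q_def A_def G_def e_def field_simps)
    qed
    ultimately show ?thesis using \<sigma> n by (simp add: C_def abs_divide abs_mult)
  qed
  have part1: "AE \<omega> in M. \<exists>E F. E \<in> O(\<lambda>N. 1 / real N * (\<Sum>n\<in>{1..<2 ^ (N + 1)}. d n / real n)) \<and>
      F \<in> o(\<lambda>N. ln (real N) powr b / sqrt (real N)) \<and>
      (\<forall>\<^sub>F N in sequentially. (\<Sum>n\<in>{1..<2 ^ (N + 1)}. h \<omega> n) / (\<Sum>n\<in>{1..<2 ^ (N + 1) :: nat}. 1 / real n) = A + E N + F N)"
    using AE_T_small[OF b]
  proof eventually_elim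
    case (elim \<omega>)
    then show ?case
      by (intro logarithmic_average_expansion[OF _ q C0 d0]) (use b in \<open>auto simp: hZ T_def\<close>)
  qed
  define w where "w i = 1 / (sqrt (real (i + 2)) * ln (real (i + 2)) powr b)" for i :: nat
  have part2: "AE \<omega> in M. summable (\<lambda>i. w i * ((\<Sum>n\<in>{2 ^ (i + 2)..<2 ^ (i + 2 + 1) :: nat}. h \<omega> n) - A * ln 2))"
    if "summable (\<lambda>i. w i * (\<Sum>n\<in>{2 ^ (i + 2)..<2 ^ (i + 2 + 1) :: nat}. d n / real n))"
    using AE_T_summable[OF b]
  proof eventually_elim
    case (elim \<omega>)
    show ?case
    proof (rule summable_weighted_dyadic_blocks[OF _ _ that _ q])
      show "0 \<le> w i" "w i \<le> 1 / ln 2 powr b" for i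
        unfolding w_def using b by (intro dyadic_weight_bounds; simp)+
      have "T (i + 3) \<omega> - T (i + 2) \<omega> = (\<Sum>n\<in>{2 ^ (i + 2)..<2 ^ (i + 2 + 1) :: nat}. h \<omega> n - q n)" for i
        using T_diff[of "i + 2" "i + 3" \<omega>] by (simp add: hZ numeral_3_eq_3)
      then show "summable (\<lambda>i. w i * (\<Sum>n\<in>{2 ^ (i + 2)..<2 ^ (i + 2 + 1) :: nat}. h \<omega> n - q n))"
        using elim by (simp add: w_def)
    qed
  qed
  have part3: "summable (\<lambda>i. w i * (\<Sum>n\<in>{2 ^ (i + 2)..<2 ^ (i + 2 + 1) :: nat}. d n / real n))"
    if "(\<lambda>n. max (\<delta> n) \<bar>\<epsilon> n\<bar>) \<in> O(\<lambda>n. ln (real n) powr (- 1/2))"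
    unfolding w_def
  proof (rule summable_weighted_dyadic_errors)
    have "d \<in> O(\<lambda>n. max (\<delta> n) \<bar>\<epsilon> n\<bar>)"
      using \<delta>0 by (intro bigoI[where c = 2] always_eventually) (auto simp: d_def)
    then show "d \<in> O(\<lambda>n. ln (real n) powr (- 1/2))" using that by (rule landau_o.big_trans)
  qed (use b in simp)
  have A2: "D * ln 2 / (\<sigma> * sqrt (2 * pi)) * exp (- (\<kappa>\<^sup>2 / (2 * \<sigma>\<^sup>2))) = A * ln 2"
    by (simp add: A_def)
  show ?thesis
    unfolding Let_def A2
    using part1 part2 part3 unfolding w_def h_def d_def A_def by blast
qed

end
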